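(* A topological group $G$ is isomorphic, as a topological group, to a topological subgroup of a monothetic topological group if and only if $G$ is abelian, $\aleph_0$-bounded, and has weight $\leq \mathfrak{c}$.
   Context: A topological group is monothetic if it contains an element generating a dense cyclic subgroup (no local compactness is assumed). A topological group $G$ is $\aleph_0$-bounded if for every nonempty open subset $U\subseteq G$, $G$ is covered by countably many translates of $U$. The weight of a topological space is the least cardinality of a base of its topology, and $\mathfrak{c}=2^{\aleph_0}$. A topological subgroup is a subgroup equipped with the subspace topology.
   Formalization: All topological groups, including the monothetic one, are taken to be Hausdorff, since a nonabelian indiscrete group is monothetic; the monothetic group is taken with elements in the double power set of the naturals, which loses nothing up to isomorphism. *)

theory Defs
  imports "HOL-Analysis.Analysis" "HOL-Algebra.Generated_Groups"
begin

unbundle cardinal_syntax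

text \<open>
  Topological groups are Hausdorff by convention. The convention cannot be dropped: with the
  indiscrete topology every group, abelian or not, has a dense cyclic subgroup.
\<close>

definition topological_group :: "('a, 'm) monoid_scheme \<Rightarrow> 'a topology \<Rightarrow> bool" where
  "topological_group G T \<longleftrightarrow>
     group G \<and> topspace T = carrier G \<and> Hausdorff_space T \<and>
     continuous_map (prod_topology T T) T (\<lambda>(x, y). x \<otimes>\<^bsub>G\<^esub> y) \<and>
     continuous_map T T (\<lambda>x. inv\<^bsub>G\<^esub> x)"

definition monothetic :: "('a, 'm) monoid_scheme \<Rightarrow> 'a topology \<Rightarrow> bool" where
  "monothetic G T \<longleftrightarrow> (\<exists>x\<in>carrier G. T closure_of (generate G {x}) = topspace T)"

text \<open>
  Only left translates occur: replacing \<open>U\<close> by its set of inverses shows that right translates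
  give the same notion.
\<close>

definition aleph0_bounded :: "('a, 'm) monoid_scheme \<Rightarrow> 'a topology \<Rightarrow> bool" where
  "aleph0_bounded G T \<longleftrightarrow>
     (\<forall>U. openin T U \<and> U \<noteq> {} \<longrightarrow>
        (\<exists>C. C \<subseteq> carrier G \<and> countable C \<and> carrier G = (\<Union>c\<in>C. c <#\<^bsub>G\<^esub> U)))"

definition base_of :: "'a topology \<Rightarrow> 'a set set \<Rightarrow> bool" where
  "base_of T \<B> \<longleftrightarrow>
     (\<forall>V\<in>\<B>. openin T V) \<and>
     (\<forall>U x. openin T U \<and> x \<in> U \<longrightarrow> (\<exists>V\<in>\<B>. x \<in> V \<and> V \<subseteq> U))"

text \<open>Cardinals are represented, as in the library, by minimal well-orders; a base of
  least cardinality exists by \<open>weight_witness\<close> below.\<close>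

definition weight :: "'a topology \<Rightarrow> 'a set rel" where
  "weight T = |SOME \<B>. base_of T \<B> \<and> (\<forall>\<C>. base_of T \<C> \<longrightarrow> |\<B>| \<le>o |\<C>| )|"

abbreviation continuum :: "(nat \<Rightarrow> bool) rel" where
  "continuum \<equiv> ctwo ^c natLeq"

definition topological_group_iso ::
  "('a, 'm) monoid_scheme \<Rightarrow> 'a topology \<Rightarrow> ('b, 'n) monoid_scheme \<Rightarrow> 'b topology \<Rightarrow> ('a \<Rightarrow> 'b) \<Rightarrow> bool"
  where
  "topological_group_iso G T H S f \<longleftrightarrow> f \<in> iso G H \<and> homeomorphic_map T S f"

definition iso_to_topological_subgroup ::
  "('a, 'm) monoid_scheme \<Rightarrow> 'a topology \<Rightarrow> ('b, 'n) monoid_scheme \<Rightarrow> 'b topology \<Rightarrow> bool"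
  where
  "iso_to_topological_subgroup G T H S \<longleftrightarrow>
     (\<exists>K f. subgroup K H \<and> topological_group_iso G T (H\<lparr>carrier := K\<rparr>) (subtopology S K) f)"

text \<open>
  HOL cannot quantify existentially over the type of the elements of the ambient monothetic group.
  A Hausdorff space with a countable dense subset has at most \<open>2 ^ 2 ^ \<aleph>\<^sub>0\<close> points, so
  it is no restriction to take the elements in \<^typ>\<open>nat set set\<close>; the lemma
  \<open>embeds_in_monothetic_group_if\<close> below proves this for ambient groups over any type.
\<close>

definition embeds_in_monothetic_group :: "('a, 'm) monoid_scheme \<Rightarrow> 'a topology \<Rightarrow> bool" where
  "embeds_in_monothetic_group G T \<longleftrightarrow>
     (\<exists>(H :: nat set set monoid) S.
        topological_group H S \<and> monothetic H S \<and> iso_to_topological_subgroup G T H S)"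

lemma weight_witness:
  obtains \<B> where "base_of T \<B>" "weight T = |\<B>|" "\<And>\<C>. base_of T \<C> \<Longrightarrow> |\<B>| \<le>o |\<C>|"
proof -
  have "base_of T {U. openin T U}"
    by (auto simp: base_of_def)
  then have "card_of ` {\<B>. base_of T \<B>} \<noteq> {}"
    by blast
  then obtain r where "r \<in> card_of ` {\<B>. base_of T \<B>}"
    "\<forall>r' \<in> card_of ` {\<B>. base_of T \<B>}. r \<le>o r'"
    using exists_minim_Card_order[of "card_of ` {\<B>. base_of T \<B>}"]
    by (auto simp: card_of_Card_order)
  then have "\<exists>\<B>. base_of T \<B> \<and> (\<forall>\<C>. base_of T \<C> \<longrightarrow> |\<B>| \<le>o |\<C>| )"
    by auto
  from someI_ex[OF this] show ?thesis
    using that unfolding weight_def by blast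
qed

lemma weight_ordLeq_iff: "weight T \<le>o r \<longleftrightarrow> (\<exists>\<B>. base_of T \<B> \<and> |\<B>| \<le>o r)"
  by (metis ordLeq_transitive weight_witness)

lemma Hausdorff_separable_inject:
  fixes e :: "nat \<Rightarrow> 'a"
  assumes "Hausdorff_space S" and dense: "S closure_of (range e) = topspace S"
  shows "inj_on (\<lambda>h. {A. h \<in> S closure_of (e ` A)}) (topspace S)"
proof (rule inj_onI, rule ccontr)
  fix h k assume hk: "h \<in> topspace S" "k \<in> topspace S" "h \<noteq> k"
    and eq: "{A. h \<in> S closure_of (e ` A)} = {A. k \<in> S closure_of (e ` A)}"
  obtain U V where UV: "openin S U" "openin S V" "h \<in> U" "k \<in> V" "disjnt U V"
    using assms(1) hk unfolding Hausdorff_space_def by metis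
  let ?A = "{n. e n \<in> U}"
  have "h \<in> S closure_of (e ` ?A)"
    unfolding in_closure_of
  proof (intro conjI allI impI)
    fix W assume W: "h \<in> W \<and> openin S W"
    then have "openin S (W \<inter> U)" "h \<in> W \<inter> U" using UV by auto
    moreover have "h \<in> S closure_of (range e)" using dense hk by simp
    ultimately obtain y where "y \<in> range e" "y \<in> W \<inter> U"
      unfolding in_closure_of by meson
    then show "\<exists>y. y \<in> e ` ?A \<and> y \<in> W" by auto
  qed (rule hk)
  moreover have "k \<notin> S closure_of (e ` ?A)"
    using UV unfolding in_closure_of disjnt_iff by blast
  ultimately show False using eq by blast
qed

lemma monothetic_group_transfer:
  fixes H :: "('b, 'n) monoid_scheme"
  assumes top: "topological_group H S" and mono: "monothetic H S"
  obtains H' :: "nat set set monoid" and S' j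
  where "topological_group H' S'" "monothetic H' S'" "topological_group_iso H S H' S' j"
proof -
  interpret group H using top by (simp add: topological_group_def)
  have tS: "topspace S = carrier H" and haus: "Hausdorff_space S"
    and cm: "continuous_map (prod_topology S S) S (\<lambda>(x, y). x \<otimes>\<^bsub>H\<^esub> y)"
    and ci: "continuous_map S S (\<lambda>x. inv\<^bsub>H\<^esub> x)"
    using top by (auto simp: topological_group_def)
  obtain x where x: "x \<in> carrier H" "S closure_of (generate H {x}) = topspace S"
    using mono by (auto simp: monothetic_def)
  define e :: "nat \<Rightarrow> 'b" where "e n = x [^]\<^bsub>H\<^esub> int_decode n" for n
  have "range e = range (\<lambda>k::int. x [^]\<^bsub>H\<^esub> k)"
    using image_image[of "\<lambda>k::int. x [^]\<^bsub>H\<^esub> k" int_decode UNIV] by (simp add: e_def surj_int_decode)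
  then have "generate H {x} = range e"
    using generate_pow[OF x(1)] by auto
  with x Hausdorff_separable_inject[OF haus, of e]
  obtain j :: "'b \<Rightarrow> nat set set" where j: "inj_on j (carrier H)"
    unfolding tS by auto
  define C where "C = j ` carrier H"
  define g where "g = inv_into (carrier H) j"
  have gj [simp]: "g (j a) = a" if "a \<in> carrier H" for a
    using that j by (simp add: g_def)
  have gC [simp]: "g u \<in> carrier H" and jg [simp]: "j (g u) = u" if "u \<in> C" for u
    using that j by (auto simp: C_def)
  have jC [simp]: "j a \<in> C" if "a \<in> carrier H" for a
    using that by (simp add: C_def)
  define H' :: "nat set set monoid" where
    "H' = \<lparr>carrier = C, mult = (\<lambda>u v. j (g u \<otimes>\<^bsub>H\<^esub> g v)), one = j \<one>\<^bsub>H\<^esub>\<rparr>"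
  define S' where "S' = pullback_topology C g S"
  have H'_simps [simp]: "carrier H' = C" "\<one>\<^bsub>H'\<^esub> = j \<one>\<^bsub>H\<^esub>" "u \<otimes>\<^bsub>H'\<^esub> v = j (g u \<otimes>\<^bsub>H\<^esub> g v)" for u v
    by (simp_all add: H'_def)
  have tS': "topspace S' = C"
    by (auto simp: S'_def topspace_pullback_topology tS)
  have grp: "group H'"
  proof (rule groupI)
    fix u assume u: "u \<in> carrier H'"
    show "\<exists>y\<in>carrier H'. y \<otimes>\<^bsub>H'\<^esub> u = \<one>\<^bsub>H'\<^esub>"
      by (rule bexI[of _ "j (inv\<^bsub>H\<^esub> (g u))"]) (use u in auto)
  qed (auto simp: m_assoc)
  interpret H': group H' by (rule grp)
  have inv': "inv\<^bsub>H'\<^esub> u = j (inv\<^bsub>H\<^esub> (g u))" if "u \<in> C" for u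
    by (rule H'.inv_equality) (use that in auto)
  have cg: "continuous_map S' S g"
    unfolding S'_def by (rule continuous_map_pullback[of S S id, simplified])
  have into: "continuous_map X S' f"
    if "continuous_map X S (g \<circ> f)" "f \<in> topspace X \<rightarrow> C" for X :: "'c topology" and f
    unfolding S'_def by (rule continuous_map_pullback') (use that in auto)
  have cj: "continuous_map S S' j"
    by (rule into) (auto simp: tS intro: continuous_map_eq[OF continuous_map_id])
  have homeo: "homeomorphic_map S S' j"
    unfolding homeomorphic_map_maps homeomorphic_maps_def
    using cg cj by (auto simp: tS tS')
  have "continuous_map (prod_topology S' S') S' (\<lambda>(u, v). u \<otimes>\<^bsub>H'\<^esub> v)"
  proof (rule into)
    have "continuous_map (prod_topology S' S') (prod_topology S S) (\<lambda>p. (g (fst p), g (snd p)))"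
      using cg by (auto simp: continuous_map_pairwise o_def
          intro: continuous_map_compose[OF continuous_map_fst, unfolded o_def]
            continuous_map_compose[OF continuous_map_snd, unfolded o_def])
    from continuous_map_compose[OF this cm]
    show "continuous_map (prod_topology S' S') S (g \<circ> (\<lambda>(u, v). u \<otimes>\<^bsub>H'\<^esub> v))"
      by (rule continuous_map_eq) (auto simp: tS')
  qed (auto simp: tS')
  moreover have "continuous_map S' S' (\<lambda>u. inv\<^bsub>H'\<^esub> u)"
  proof (rule into)
    show "continuous_map S' S (g \<circ> (\<lambda>u. inv\<^bsub>H'\<^esub> u))"
      by (rule continuous_map_eq[OF continuous_map_compose[OF cg ci]]) (auto simp: tS' inv')
  qed (auto simp: tS' inv')
  moreover have "Hausdorff_space S'"
    using homeomorphic_Hausdorff_space[OF homeomorphic_map_imp_homeomorphic_space[OF homeo]] haus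
    by simp
  ultimately have "topological_group H' S'"
    using grp tS' by (simp add: topological_group_def)
  moreover have iso: "j \<in> iso H H'"
    using j by (auto simp: iso_def hom_def bij_betw_def C_def)
  moreover have "monothetic H' S'"
  proof -
    interpret group_hom H H' j
      by unfold_locales (use iso in \<open>auto simp: iso_def\<close>)
    have "j ` generate H {x} = generate H' {j x}"
      using generate_img[of "{x}"] x(1) by simp
    then have "S' closure_of (generate H' {j x}) = j ` (S closure_of (generate H {x}))"
      using homeomorphic_map_closure_of[OF homeo, of "generate H {x}"] x(1) tS generate_incl[of "{x}"]
      by simp
    then have "S' closure_of (generate H' {j x}) = topspace S'"
      using x(2) by (simp add: tS tS' C_def)
    then show ?thesis using x(1) by (auto simp: monothetic_def)
  qed
  ultimately show ?thesis
    using that homeo by (auto simp: topological_group_iso_def)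
qed

lemma embeds_in_monothetic_group_if:
  fixes H :: "('b, 'n) monoid_scheme"
  assumes "topological_group H S" and "monothetic H S" and "iso_to_topological_subgroup G T H S"
  shows "embeds_in_monothetic_group G T"
proof -
  obtain H' :: "nat set set monoid" and S' j where H':
    "topological_group H' S'" "monothetic H' S'" and j: "topological_group_iso H S H' S' j"
    using monothetic_group_transfer[OF assms(1,2)] by blast
  obtain K f where K: "subgroup K H"
    and f: "f \<in> iso G (H\<lparr>carrier := K\<rparr>)" "homeomorphic_map T (subtopology S K) f"
    using assms(3) by (auto simp: iso_to_topological_subgroup_def topological_group_iso_def)
  have j': "j \<in> iso H H'" "homeomorphic_map S S' j"
    using j by (auto simp: topological_group_iso_def)
  have tops: "topspace S = carrier H" "topspace S' = carrier H'" "group H" "group H'"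
    using assms(1) H'(1) by (auto simp: topological_group_def)
  have KH: "K \<subseteq> carrier H" using K by (rule subgroup.subset)
  interpret group_hom H H' j
    by (rule group_hom.intro) (use tops j'(1) in \<open>auto simp: group_hom_axioms_def iso_def\<close>)
  have "subgroup (j ` K) H'"
    using K by (rule subgroup_img_is_subgroup)
  moreover have "j \<in> iso (H\<lparr>carrier := K\<rparr>) (H'\<lparr>carrier := j ` K\<rparr>)"
    using j'(1) KH by (auto simp: iso_def hom_def bij_betw_def inj_on_subset subset_iff)
  then have "j \<circ> f \<in> iso G (H'\<lparr>carrier := j ` K\<rparr>)"
    by (rule iso_set_trans[OF f(1)])
  moreover have "homeomorphic_map (subtopology S K) (subtopology S' (j ` K)) j"
    using j'(2) by (rule homeomorphic_map_subtopologies) 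
      (use KH tops j'(1) in \<open>auto simp: iso_def bij_betw_def\<close>)
  then have "homeomorphic_map T (subtopology S' (j ` K)) (j \<circ> f)"
    by (rule homeomorphic_map_compose[OF f(2)])
  ultimately show ?thesis
    using H' unfolding embeds_in_monothetic_group_def iso_to_topological_subgroup_def
      topological_group_iso_def by blast
qed

end

theory Submission
  imports Defs "HOL-Algebra.Elementary_Groups"
begin

text \<open>
  For a monothetic group, the closures of the subsets of the dense cyclic group determine a base of
  cardinality at most the continuum, and translates by the elements of the cyclic group give
  \<open>\<aleph>\<^sub>0\<close>-boundedness; both properties, and commutativity, pass to subgroups.

  Conversely, the topology of \<open>G\<close> is given by continuous seminorms \<open>p i \<le> 1\<close> indexed by binary sequences,
  each with a countable dense set. The seminorm \<open>p i\<close> is extended to \<open>G \<times> \<int>\<close> as the largest one that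
  gives \<open>(s i n, (n + 1)!)\<close> length at most \<open>1 / (n + 1)\<close>. It still induces \<open>p i\<close> on \<open>G\<close>: a combination
  of these elements with trivial \<open>\<int>\<close>-component and total weight below 1 has all coefficients zero,
  because \<open>1 * 1! + \<dots> + k * k! < (k + 1)!\<close>. If the sequences \<open>s i\<close> are chosen
  independently, so that finitely many of them simultaneously approximate any given element
  infinitely often, then \<open>-(n + 1)!\<close> in \<open>\<int>\<close> comes close to every element of \<open>G\<close> for suitable \<open>n\<close>,
  and \<open>\<int>\<close> is dense.
\<close>

section \<open>Topologies defined by seminorms\<close>

definition group_seminorm :: "('a, 'm) monoid_scheme \<Rightarrow> ('a \<Rightarrow> real) \<Rightarrow> bool" where
  "group_seminorm G p \<longleftrightarrow>
     p \<one>\<^bsub>G\<^esub> = 0 \<and> (\<forall>x\<in>carrier G. 0 \<le> p x \<and> p (inv\<^bsub>G\<^esub> x) = p x) \<and>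
     (\<forall>x\<in>carrier G. \<forall>y\<in>carrier G. p (x \<otimes>\<^bsub>G\<^esub> y) \<le> p x + p y)"

text \<open>Read \<open>R x r\<close> as: \<open>x\<close> can be represented at cost
  \<open>r\<close>. Representations of two factors combine with added costs, so the least cost is
  subadditive. Both seminorms constructed later, from neighbourhoods and on G \<times> \<int>, have
  this form.\<close>

lemma (in group) group_seminorm_Inf:
  fixes R :: "'a \<Rightarrow> real \<Rightarrow> bool"
  assumes one: "R \<one> 0"
    and nonneg: "\<And>x r. R x r \<Longrightarrow> 0 \<le> r"
    and ex: "\<And>x. x \<in> carrier G \<Longrightarrow> \<exists>r. R x r"
    and mult: "\<And>x y r s. \<lbrakk>x \<in> carrier G; y \<in> carrier G; R x r; R y s\<rbrakk> \<Longrightarrow> R (x \<otimes> y) (r + s)"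
    and inv: "\<And>x r. \<lbrakk>x \<in> carrier G; R x r\<rbrakk> \<Longrightarrow> R (inv x) r"
  shows "group_seminorm G (\<lambda>x. Inf {r. R x r})"
proof -
  have bdd: "bdd_below {r. R x r}" for x
    using nonneg by (auto intro: bdd_belowI[of _ 0])
  have inv_iff: "R (inv x) r \<longleftrightarrow> R x r" if "x \<in> carrier G" for x r
    using inv[of x r] inv[of "inv x" r] that by auto
  have pos: "0 \<le> Inf {r. R x r}" if "x \<in> carrier G" for x
    using ex[OF that] nonneg by (intro cInf_greatest) auto
  have "Inf {r. R \<one> r} = 0"
    using bdd one pos[of \<one>] by (intro antisym cInf_lower) auto
  moreover have "Inf {r. R (inv x) r} = Inf {r. R x r}" if "x \<in> carrier G" for x
    using inv_iff[OF that] by simp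
  moreover have "Inf {r. R (x \<otimes> y) r} \<le> Inf {r. R x r} + Inf {r. R y r}"
    if xy: "x \<in> carrier G" "y \<in> carrier G" for x y
  proof -
    have "Inf {r. R (x \<otimes> y) r} - s \<le> Inf {r. R x r}" if "R y s" for s
    proof (rule cInf_greatest)
      fix r assume "r \<in> {r. R x r}"
      then have "R (x \<otimes> y) (r + s)" using mult xy that by auto
      then have "Inf {r. R (x \<otimes> y) r} \<le> r + s"
        using bdd by (intro cInf_lower) auto
      then show "Inf {r. R (x \<otimes> y) r} - s \<le> r" by simp
    qed (use ex[OF xy(1)] in auto)
    then have "Inf {r. R (x \<otimes> y) r} - Inf {r. R x r} \<le> Inf {r. R y r}"
      using ex[OF xy(2)] by (intro cInf_greatest) (auto simp: algebra_simps)
    then show ?thesis by simp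
  qed
  ultimately show ?thesis
    using pos by (simp add: group_seminorm_def)
qed

definition seminorm_ball ::
  "('a, 'm) monoid_scheme \<Rightarrow> ('i \<Rightarrow> 'a \<Rightarrow> real) \<Rightarrow> 'i set \<Rightarrow> real \<Rightarrow> 'a \<Rightarrow> 'a set" where
  "seminorm_ball G N F e x = {y \<in> carrier G. \<forall>i\<in>F. N i (y \<otimes>\<^bsub>G\<^esub> inv\<^bsub>G\<^esub> x) < e}"

text \<open>For seminorms \<open>N i\<close>, this is the topology of the invariant pseudometrics
  \<open>N i (y \<otimes> inv x)\<close>. Since it is given by a condition on open sets, openness of
  the balls has to be proved.\<close>

definition seminorm_topology :: "('a, 'm) monoid_scheme \<Rightarrow> ('i \<Rightarrow> 'a \<Rightarrow> real) \<Rightarrow> 'a topology" where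
  "seminorm_topology G N = topology (\<lambda>U. U \<subseteq> carrier G \<and>
     (\<forall>x\<in>U. \<exists>F e. finite F \<and> 0 < e \<and> seminorm_ball G N F e x \<subseteq> U))"

lemma openin_seminorm_topology:
  "openin (seminorm_topology G N) U \<longleftrightarrow> U \<subseteq> carrier G \<and>
     (\<forall>x\<in>U. \<exists>F e. finite F \<and> 0 < e \<and> seminorm_ball G N F e x \<subseteq> U)"
proof -
  have "istopology (\<lambda>U. U \<subseteq> carrier G \<and>
     (\<forall>x\<in>U. \<exists>F e. finite F \<and> 0 < e \<and> seminorm_ball G N F e x \<subseteq> U))"
    unfolding istopology_def
  proof (intro conjI allI impI ballI)
    fix S T x
    assume S: "S \<subseteq> carrier G \<and> (\<forall>x\<in>S. \<exists>F e. finite F \<and> 0 < e \<and> seminorm_ball G N F e x \<subseteq> S)"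
      and T: "T \<subseteq> carrier G \<and> (\<forall>x\<in>T. \<exists>F e. finite F \<and> 0 < e \<and> seminorm_ball G N F e x \<subseteq> T)"
      and x: "x \<in> S \<inter> T"
    obtain F e where "finite F" "0 < e" "seminorm_ball G N F e x \<subseteq> S" using S x by blast
    moreover obtain F' e' where "finite F'" "0 < e'" "seminorm_ball G N F' e' x \<subseteq> T" using T x by blast
    ultimately have "finite (F \<union> F')" "0 < min e e'"
      "seminorm_ball G N (F \<union> F') (min e e') x \<subseteq> S \<inter> T"
      by (auto simp: seminorm_ball_def)
    then show "\<exists>F e. finite F \<and> 0 < e \<and> seminorm_ball G N F e x \<subseteq> S \<inter> T" by blast
  next
    fix K x
    assume K: "\<forall>U\<in>K. U \<subseteq> carrier G \<and> (\<forall>x\<in>U. \<exists>F e. finite F \<and> 0 < e \<and> seminorm_ball G N F e x \<subseteq> U)"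
      and "x \<in> \<Union>K"
    then obtain U where "U \<in> K" "x \<in> U" by blast
    then show "\<exists>F e. finite F \<and> 0 < e \<and> seminorm_ball G N F e x \<subseteq> \<Union>K"
      using K by (meson Union_upper order_trans)
  qed blast+
  then show ?thesis
    by (simp add: seminorm_topology_def topology_inverse')
qed

lemma topspace_seminorm_topology: "topspace (seminorm_topology G N) = carrier G"
proof
  show "topspace (seminorm_topology G N) \<subseteq> carrier G"
    using openin_topspace[of "seminorm_topology G N"] unfolding openin_seminorm_topology by blast
  have "seminorm_ball G N {} 1 x \<subseteq> carrier G" for x by (auto simp: seminorm_ball_def)
  then have "openin (seminorm_topology G N) (carrier G)"
    unfolding openin_seminorm_topology by (metis finite.emptyI order_refl zero_less_one)
  then show "carrier G \<subseteq> topspace (seminorm_topology G N)" by (rule openin_subset)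
qed

locale seminormed_group = comm_group G for G (structure) +
  fixes N :: "'i \<Rightarrow> 'a \<Rightarrow> real"
  assumes seminorm: "group_seminorm G (N i)"
    and separating: "\<lbrakk>x \<in> carrier G; x \<noteq> \<one>\<rbrakk> \<Longrightarrow> \<exists>i. 0 < N i x"
begin

lemma N_one: "N i \<one> = 0"
  and N_inv: "x \<in> carrier G \<Longrightarrow> N i (inv x) = N i x"
  and N_mult: "\<lbrakk>x \<in> carrier G; y \<in> carrier G\<rbrakk> \<Longrightarrow> N i (x \<otimes> y) \<le> N i x + N i y"
  using seminorm[of i] by (auto simp: group_seminorm_def)

lemma N_diff_triangle:
  assumes "x \<in> carrier G" "y \<in> carrier G" "z \<in> carrier G"
  shows "N i (x \<otimes> inv z) \<le> N i (x \<otimes> inv y) + N i (y \<otimes> inv z)"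
proof -
  have "x \<otimes> inv z = (x \<otimes> inv y) \<otimes> (y \<otimes> inv z)"
    using assms by (simp add: m_assoc inv_solve_left)
  then show ?thesis using N_mult[of "x \<otimes> inv y" "y \<otimes> inv z" i] assms by simp
qed

lemma centre_in_seminorm_ball: "\<lbrakk>x \<in> carrier G; 0 < e\<rbrakk> \<Longrightarrow> x \<in> seminorm_ball G N F e x"
  by (simp add: seminorm_ball_def N_one)

lemma openin_seminorm_ball:
  assumes "finite F" "0 < e" "x \<in> carrier G"
  shows "openin (seminorm_topology G N) (seminorm_ball G N F e x)"
  unfolding openin_seminorm_topology
proof (intro conjI ballI)
  fix y assume y: "y \<in> seminorm_ball G N F e x"
  \<comment> \<open>The smallest slack left at \<open>y\<close> among the seminorms in
    \<open>F\<close>; the entry 1 covers empty \<open>F\<close>.\<close>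
  define d where "d = Min (insert 1 ((\<lambda>i. e - N i (y \<otimes> inv x)) ` F))"
  have "0 < d" using y assms by (auto simp: d_def seminorm_ball_def)
  moreover have "seminorm_ball G N F d y \<subseteq> seminorm_ball G N F e x"
  proof
    fix z assume z: "z \<in> seminorm_ball G N F d y"
    have "N i (z \<otimes> inv x) < e" if "i \<in> F" for i
    proof -
      have "d \<le> e - N i (y \<otimes> inv x)" using assms that by (auto simp: d_def)
      moreover have "N i (z \<otimes> inv y) < d" using z that by (auto simp: seminorm_ball_def)
      ultimately show ?thesis
        using N_diff_triangle[of z y x i] y z assms by (auto simp: seminorm_ball_def)
    qed
    then show "z \<in> seminorm_ball G N F e x" using z by (auto simp: seminorm_ball_def)
  qed
  ultimately show "\<exists>F' d. finite F' \<and> 0 < d \<and> seminorm_ball G N F' d y \<subseteq> seminorm_ball G N F e x"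
    using assms by blast
qed (auto simp: seminorm_ball_def)

lemma topological_group_seminorm_topology: "topological_group G (seminorm_topology G N)"
proof -
  let ?T = "seminorm_topology G N"
  have "Hausdorff_space ?T"
    unfolding Hausdorff_space_def topspace_seminorm_topology
  proof (intro allI impI, elim conjE)
    fix x y assume xy: "x \<in> carrier G" "y \<in> carrier G" "x \<noteq> y"
    then have "x \<otimes> inv y \<noteq> \<one>" using inv_equality[of x "inv y"] by auto
    then obtain i where i: "0 < N i (x \<otimes> inv y)" using separating[of "x \<otimes> inv y"] xy by auto
    let ?e = "N i (x \<otimes> inv y) / 2"
    have "disjnt (seminorm_ball G N {i} ?e x) (seminorm_ball G N {i} ?e y)"
      unfolding disjnt_iff
    proof (intro allI notI, elim conjE)
      fix z assume z: "z \<in> seminorm_ball G N {i} ?e x" "z \<in> seminorm_ball G N {i} ?e y"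
      then have "z \<in> carrier G" by (simp add: seminorm_ball_def)
      moreover have "x \<otimes> inv z = inv (z \<otimes> inv x)"
        using \<open>z \<in> carrier G\<close> xy by (simp add: inv_mult_group)
      ultimately show False
        using z xy N_inv[of "z \<otimes> inv x" i] N_diff_triangle[of x z y i]
        by (auto simp: seminorm_ball_def)
    qed
    then show "\<exists>U V. openin ?T U \<and> openin ?T V \<and> x \<in> U \<and> y \<in> V \<and> disjnt U V"
      using i xy by (intro exI[of _ "seminorm_ball G N {i} ?e x"] exI[of _ "seminorm_ball G N {i} ?e y"]
          conjI openin_seminorm_ball centre_in_seminorm_ball) auto
  qed
  moreover have "continuous_map (prod_topology ?T ?T) ?T (\<lambda>(x, y). x \<otimes> y)"
    unfolding continuous_map topspace_prod_topology topspace_seminorm_topology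
  proof (intro conjI allI impI)
    fix U assume U: "openin ?T U"
    show "openin (prod_topology ?T ?T) {a \<in> carrier G \<times> carrier G. (case a of (x, y) \<Rightarrow> x \<otimes> y) \<in> U}"
      unfolding openin_prod_topology_alt
    proof (intro allI impI)
      fix x y assume "(x, y) \<in> {a \<in> carrier G \<times> carrier G. (case a of (x, y) \<Rightarrow> x \<otimes> y) \<in> U}"
      then have xy: "x \<in> carrier G" "y \<in> carrier G" "x \<otimes> y \<in> U" by auto
      then obtain F e where F: "finite F" "0 < e" "seminorm_ball G N F e (x \<otimes> y) \<subseteq> U"
        using U unfolding openin_seminorm_topology by blast
      have "u \<otimes> v \<in> U" if uv: "u \<in> seminorm_ball G N F (e/2) x" "v \<in> seminorm_ball G N F (e/2) y" for u v
      proof -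
        have c: "u \<in> carrier G" "v \<in> carrier G" using uv by (auto simp: seminorm_ball_def)
        then have "(u \<otimes> v) \<otimes> inv (x \<otimes> y) = (u \<otimes> inv x) \<otimes> (v \<otimes> inv y)"
          using xy by (simp add: inv_mult m_ac)
        moreover have "N i ((u \<otimes> inv x) \<otimes> (v \<otimes> inv y)) < e" if "i \<in> F" for i
        proof -
          have "N i (u \<otimes> inv x) < e/2" "N i (v \<otimes> inv y) < e/2"
            using uv that by (auto simp: seminorm_ball_def)
          then show ?thesis using N_mult[of "u \<otimes> inv x" "v \<otimes> inv y" i] c xy by simp
        qed
        ultimately have "u \<otimes> v \<in> seminorm_ball G N F e (x \<otimes> y)"
          using c by (auto simp: seminorm_ball_def)
        then show ?thesis using F by blast
      qed
      then have "seminorm_ball G N F (e/2) x \<times> seminorm_ball G N F (e/2) y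
          \<subseteq> {a \<in> carrier G \<times> carrier G. (case a of (x, y) \<Rightarrow> x \<otimes> y) \<in> U}"
        by (auto simp: seminorm_ball_def)
      then show "\<exists>V W. openin ?T V \<and> openin ?T W \<and> x \<in> V \<and> y \<in> W \<and>
          V \<times> W \<subseteq> {a \<in> carrier G \<times> carrier G. (case a of (x, y) \<Rightarrow> x \<otimes> y) \<in> U}"
        using F xy by (intro exI[of _ "seminorm_ball G N F (e/2) x"] exI[of _ "seminorm_ball G N F (e/2) y"]
            conjI openin_seminorm_ball centre_in_seminorm_ball) auto
    qed
  qed auto
  moreover have "continuous_map ?T ?T (\<lambda>x. inv x)"
    unfolding continuous_map topspace_seminorm_topology
  proof (intro conjI allI impI)
    fix U assume U: "openin ?T U"
    show "openin ?T {x \<in> carrier G. inv x \<in> U}"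
      unfolding openin_seminorm_topology
    proof (intro conjI ballI)
      fix x assume "x \<in> {x \<in> carrier G. inv x \<in> U}"
      then have x: "x \<in> carrier G" "inv x \<in> U" by auto
      then obtain F e where F: "finite F" "0 < e" "seminorm_ball G N F e (inv x) \<subseteq> U"
        using U unfolding openin_seminorm_topology by blast
      have "inv u \<in> U" if u: "u \<in> seminorm_ball G N F e x" for u
      proof -
        have c: "u \<in> carrier G" using u by (auto simp: seminorm_ball_def)
        then have "inv u \<otimes> inv (inv x) = inv (u \<otimes> inv x)"
          using x by (simp add: inv_mult)
        then have "inv u \<in> seminorm_ball G N F e (inv x)"
          using u c x N_inv[of "u \<otimes> inv x"] by (auto simp: seminorm_ball_def)
        then show ?thesis using F by blast
      qed
      then have "seminorm_ball G N F e x \<subseteq> {x \<in> carrier G. inv x \<in> U}"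
        by (auto simp: seminorm_ball_def)
      then show "\<exists>F e. finite F \<and> 0 < e \<and> seminorm_ball G N F e x \<subseteq> {x \<in> carrier G. inv x \<in> U}"
        using F by blast
    qed auto
  qed auto
  ultimately show ?thesis
    by (simp add: topological_group_def topspace_seminorm_topology)
qed

end

section \<open>Independent functions\<close>

text \<open>
  A natural number codes a length \<open>L\<close> together with a finite table of values for the binary
  words of length \<open>L\<close>; an index \<open>i\<close> looks up the word formed by its first \<open>L\<close> bits. The first
  component of the code is ignored, which makes every pattern occur infinitely often.
\<close>

definition independent_fun :: "(nat \<Rightarrow> bool) \<Rightarrow> nat \<Rightarrow> nat" where
  "independent_fun i n =
     (case (from_nat n :: nat \<times> nat \<times> (bool list \<times> nat) list) of
        (j, L, tab) \<Rightarrow> (case map_of tab (map i [0..<L]) of None \<Rightarrow> 0 | Some m \<Rightarrow> m))"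

text \<open>Finitely many sequences are separated pairwise by finitely many positions, and a long
  enough word contains all of them.\<close>

lemma inj_on_initial_segments:
  fixes F :: "(nat \<Rightarrow> 'b) set"
  assumes "finite F"
  shows "\<exists>L. inj_on (\<lambda>i. map i [0..<L]) F"
proof -
  have "\<forall>i\<in>F. \<forall>j\<in>F. \<exists>n. i \<noteq> j \<longrightarrow> i n \<noteq> j n" by (auto simp: fun_eq_iff)
  then obtain n where n: "\<And>i j. \<lbrakk>i \<in> F; j \<in> F; i \<noteq> j\<rbrakk> \<Longrightarrow> i (n i j) \<noteq> j (n i j)"
    by metis
  \<comment> \<open>\<open>Suc\<close> makes words of length \<open>L\<close> include the last
    separating position; the entry 0 covers empty \<open>F\<close>.\<close>
  define L where "L = Suc (Max (insert 0 ((\<lambda>(i, j). n i j) ` (F \<times> F))))"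
  have "n i j < L" if "i \<in> F" "j \<in> F" for i j
    using that assms by (auto simp: L_def less_Suc_eq_le intro!: Max_ge)
  then have "inj_on (\<lambda>i. map i [0..<L]) F"
    using n unfolding inj_on_def by (metis atLeastLessThan_iff le0 map_eq_conv set_upt)
  then show ?thesis by blast
qed

text \<open>The code of a table assigning \<open>m i\<close> to the initial word of each
  \<open>i\<close> in \<open>F\<close> is such an \<open>n\<close>; varying the ignored first
  component gives codes beyond \<open>k\<close>.\<close>

lemma independent_fun_hits:
  assumes "finite F"
  shows "\<exists>n\<ge>k. \<forall>i\<in>F. independent_fun i n = m i"
proof -
  obtain L where L: "inj_on (\<lambda>i. map i [0..<L]) F"
    using inj_on_initial_segments[OF assms] by blast
  obtain xs where xs: "set xs = F" using finite_list[OF assms] by blast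
  define tab where "tab = map (\<lambda>i. (map i [0..<L], m i)) xs"
  have tab: "map_of tab (map i [0..<L]) = Some (m i)" if "i \<in> F" for i
  proof -
    have "(map i [0..<L], m i) \<in> set tab" using that xs by (auto simp: tab_def)
    then obtain m' where m': "map_of tab (map i [0..<L]) = Some m'"
      by (metis not_None_eq weak_map_of_SomeI)
    then have "(map i [0..<L], m') \<in> set tab" by (rule map_of_SomeD)
    then obtain i' where "i' \<in> F" "map i [0..<L] = map i' [0..<L]" "m' = m i'"
      using xs by (auto simp: tab_def)
    then show ?thesis using L that m' by (metis inj_onD)
  qed
  define c where "c j = to_nat (j :: nat, L, tab)" for j
  have "inj c" by (auto simp: c_def inj_def)
  then have "infinite (range c)" by (simp add: finite_image_iff)
  then obtain j where "k \<le> c j"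
    by (metis infinite_nat_iff_unbounded_le rangeE)
  moreover have "independent_fun i (c j) = m i" if "i \<in> F" for i
    by (simp add: independent_fun_def c_def tab[OF that])
  ultimately show ?thesis by blast
qed

section \<open>Seminorms from neighbourhoods\<close>

text \<open>The entry \<open>m\<close> is the one at which the running total passes
  \<open>t\<close>. For \<open>t\<close> half of the total, both outer pieces weigh at most half, as
  needed in \<open>chain_bound\<close>.\<close>

lemma sum_list_split_at:
  fixes q :: "'a \<Rightarrow> real"
  assumes "xs \<noteq> []" "\<And>x. 0 \<le> q x" "0 \<le> t" "t \<le> sum_list (map q xs)"
  shows "\<exists>as m bs. xs = as @ m # bs \<and>
    sum_list (map q as) \<le> t \<and> sum_list (map q bs) \<le> sum_list (map q xs) - t"
  using assms
proof (induction xs arbitrary: t)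
  case (Cons x xs)
  show ?case
  \<comment> \<open>The second disjunct catches \<open>t\<close> equal to the total, which no entry
    passes strictly.\<close>
  proof (cases "t < q x \<or> xs = []")
    case True
    then have "sum_list (map q xs) \<le> sum_list (map q (x # xs)) - t" using Cons.prems by auto
    then show ?thesis using Cons.prems
      by (intro exI[of _ "[]"] exI[of _ x] exI[of _ xs]) auto
  next
    case False
    then obtain as m bs where "xs = as @ m # bs" "sum_list (map q as) \<le> t - q x"
      "sum_list (map q bs) \<le> sum_list (map q xs) - (t - q x)"
      using Cons.IH[of "t - q x"] Cons.prems by fastforce
    then show ?thesis
      by (intro exI[of _ "x # as"] exI[of _ m] exI[of _ bs]) auto
  qed
qed simp

context comm_group
begin

abbreviation list_prod :: "'a list \<Rightarrow> 'a" where
  "list_prod xs \<equiv> foldr (\<otimes>) xs \<one>"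

lemma list_prod_closed: "set xs \<subseteq> carrier G \<Longrightarrow> list_prod xs \<in> carrier G"
  by (induction xs) auto

lemma list_prod_append:
  "\<lbrakk>set xs \<subseteq> carrier G; set ys \<subseteq> carrier G\<rbrakk> \<Longrightarrow> list_prod (xs @ ys) = list_prod xs \<otimes> list_prod ys"
proof (induction xs)
  case Nil
  then show ?case using list_prod_closed[of ys] by simp
next
  case (Cons x xs)
  then show ?case using list_prod_closed[of xs] list_prod_closed[of ys] by (simp add: m_assoc)
qed

lemma list_prod_inv: "set xs \<subseteq> carrier G \<Longrightarrow> list_prod (map (m_inv G) xs) = inv (list_prod xs)"
  by (induction xs) (auto simp: inv_mult list_prod_closed)

text \<open>Induction on the length. Cut the list at half of its weight S: the outer products have
  \<open>q\<close> at most 2 (S/2) = S by induction, the entry at the cut has \<open>q\<close> at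
  most S, and \<open>triple\<close> bounds the whole by 2 S. The constant 2 thus does not grow with
  the length.\<close>

lemma chain_bound:
  fixes q :: "'a \<Rightarrow> real"
  assumes nonneg: "\<And>x. 0 \<le> q x" and one: "q \<one> = 0"
    and triple: "\<And>x y z c. \<lbrakk>x \<in> carrier G; y \<in> carrier G; z \<in> carrier G; q x \<le> c; q y \<le> c; q z \<le> c\<rbrakk>
      \<Longrightarrow> q (x \<otimes> y \<otimes> z) \<le> 2 * c"
    and "set xs \<subseteq> carrier G"
  shows "q (list_prod xs) \<le> 2 * sum_list (map q xs)"
  using \<open>set xs \<subseteq> carrier G\<close>
proof (induction xs rule: length_induct)
  case (1 xs)
  let ?S = "sum_list (map q xs)"
  have S: "0 \<le> ?S" using nonneg by (intro sum_list_nonneg) auto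
  show ?case
  proof (cases "xs = []")
    case True
    then show ?thesis by (simp add: one)
  next
    case False
    have "\<exists>as m bs. xs = as @ m # bs \<and>
        sum_list (map q as) \<le> ?S / 2 \<and> sum_list (map q bs) \<le> ?S - ?S / 2"
      by (intro sum_list_split_at False nonneg) (use S in auto)
    then obtain as m bs where xs: "xs = as @ m # bs"
      and as: "sum_list (map q as) \<le> ?S / 2" and bs: "sum_list (map q bs) \<le> ?S - ?S / 2"
      by blast
    have c: "set as \<subseteq> carrier G" "set bs \<subseteq> carrier G" "m \<in> carrier G"
      using 1 xs by auto
    have IH: "q (list_prod ys) \<le> 2 * sum_list (map q ys)"
      if "length ys < length xs" "set ys \<subseteq> carrier G" for ys
      using 1 that by blast
    have "q (list_prod as) \<le> ?S" "q (list_prod bs) \<le> ?S"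
    proof -
      have "q (list_prod as) \<le> 2 * sum_list (map q as)" "q (list_prod bs) \<le> 2 * sum_list (map q bs)"
        using IH[of as] IH[of bs] c by (simp_all add: xs)
      then show "q (list_prod as) \<le> ?S" "q (list_prod bs) \<le> ?S"
        using as bs by linarith+
    qed
    moreover have "q m \<le> ?S"
    proof -
      have "0 \<le> sum_list (map q as)" "0 \<le> sum_list (map q bs)"
        by (rule sum_list_nonneg; auto simp: nonneg)+
      then show ?thesis by (simp add: xs)
    qed
    ultimately have "q (list_prod as \<otimes> m \<otimes> list_prod bs) \<le> 2 * ?S"
      using c by (intro triple) (auto simp: list_prod_closed)
    moreover have "list_prod xs = list_prod as \<otimes> m \<otimes> list_prod bs"
      using c list_prod_append[of as "m # bs"] by (simp add: xs list_prod_closed m_assoc)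
    ultimately show ?thesis by simp
  qed
qed

text \<open>The gauge \<open>q\<close> reads off how deep in the sequence \<open>V\<close> a point
  lies. The infimum \<open>p\<close> of sums of \<open>q\<close> over factorisations is a seminorm,
  and \<open>chain_bound\<close> gives \<open>q / 2 \<le> p \<le> q\<close> on the carrier. The
  factor 2 turns the bound \<open>(1/2) ^ Suc n\<close> on \<open>p\<close> into
  \<open>(1/2) ^ n\<close> on \<open>q\<close>.\<close>

theorem birkhoff_kakutani:
  fixes V :: "nat \<Rightarrow> 'a set"
  assumes V0: "V 0 = carrier G"
    and one: "\<And>n. \<one> \<in> V n"
    and inv: "\<And>n x. \<lbrakk>x \<in> carrier G; x \<in> V n\<rbrakk> \<Longrightarrow> inv x \<in> V n"
    and triple: "\<And>n x y z. \<lbrakk>x \<in> V (Suc n); y \<in> V (Suc n); z \<in> V (Suc n)\<rbrakk> \<Longrightarrow> x \<otimes> y \<otimes> z \<in> V n"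
    and carr: "\<And>n. V n \<subseteq> carrier G"
  obtains p where "group_seminorm G p" "\<forall>x\<in>carrier G. p x \<le> 1" "\<forall>n. \<forall>x\<in>V n. p x \<le> (1/2) ^ n"
    "\<forall>n. \<forall>x\<in>carrier G. p x < (1/2) ^ Suc n \<longrightarrow> x \<in> V n"
proof -
  have "V (Suc n) \<subseteq> V n" for n
    using triple[of _ n \<one> \<one>] one carr by fastforce
  then have anti: "V n \<subseteq> V m" if "m \<le> n" for m n
    using that by (rule lift_Suc_antimono_le)
  \<comment> \<open>The inserted 1 keeps the set nonempty outside the carrier; on the carrier it is
    the term for \<open>n = 0\<close>.\<close>
  define q :: "'a \<Rightarrow> real" where "q x = Inf (insert 1 {(1/2) ^ n | n. x \<in> V n})" for x
  have bdd: "bdd_below (insert (1::real) {(1/2) ^ n | n. x \<in> V n})" for x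
    by (rule bdd_belowI[of _ 0]) auto
  have nonneg: "0 \<le> q x" for x
    unfolding q_def by (intro cInf_greatest) auto
  have le1: "q x \<le> 1" for x
    unfolding q_def using bdd by (intro cInf_lower) auto
  have le: "q x \<le> (1/2) ^ n" if "x \<in> V n" for x n
    unfolding q_def using bdd that by (intro cInf_lower) auto
  \<comment> \<open>The infimum is over powers of 1/2, so a value strictly below
    \<open>(1/2) ^ n\<close> already means membership one level deeper.\<close>
  have less: "x \<in> V (Suc n)" if "q x < (1/2) ^ n" for x n
  proof -
    have "\<exists>r \<in> insert (1::real) {(1/2) ^ n | n. x \<in> V n}. r < (1/2) ^ n"
      using that cInf_less_iff[OF insert_not_empty bdd] unfolding q_def by simp
    moreover have "\<not> (1::real) < (1/2) ^ n" by (simp add: power_le_one not_less)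
    ultimately obtain k where k: "x \<in> V k" "(1/2) ^ k < (1/2 :: real) ^ n" by auto
    then have "Suc n \<le> k" using power_decreasing[of k n "1/2::real"] by (force simp: not_less_eq_eq)
    then show ?thesis using anti k by blast
  qed
  \<comment> \<open>For \<open>c = 0\<close> the factors lie in every \<open>V n\<close>; for
    \<open>c\<close> at least 1/2 the bound \<open>q \<le> 1\<close> is enough. Otherwise let
    \<open>n\<close> be least with \<open>(1/2) ^ n \<le> c\<close>: the factors lie in
    \<open>V n\<close>, their product in \<open>V (n - 1)\<close>, and
    \<open>(1/2) ^ (n - 1) \<le> 2 * c\<close>.\<close>
  have q_triple: "q (x \<otimes> y \<otimes> z) \<le> 2 * c"
    if "q x \<le> c" "q y \<le> c" "q z \<le> c" for x y z c
  proof (cases "c = 0 \<or> 1/2 \<le> c")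
    case True
    then show ?thesis
    proof
      assume "c = 0"
      have *: "q w < (1/2) ^ n" if "q w \<le> c" for w n
        using that \<open>c = 0\<close> by (meson le_less_trans zero_less_divide_1_iff zero_less_numeral zero_less_power)
      have "q (x \<otimes> y \<otimes> z) \<le> (1/2) ^ n" for n
        using that by (intro le triple less *)
      moreover have "(\<lambda>n. (1/2 :: real) ^ n) \<longlonglongrightarrow> 0"
        by (intro LIMSEQ_realpow_zero) auto
      ultimately show ?thesis
        using \<open>c = 0\<close> by (auto intro: LIMSEQ_le_const)
    next
      assume "1/2 \<le> c"
      then show ?thesis using le1[of "x \<otimes> y \<otimes> z"] by simp
    qed
  next
    case False
    then have c: "0 < c" "c < 1/2" using that nonneg[of x] by auto
    obtain k where k: "(1/2 :: real) ^ k < c" using real_arch_pow_inv[of c "1/2"] c by auto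
    define n where "n = (LEAST k. (1/2 :: real) ^ k \<le> c)"
    have n: "(1/2 :: real) ^ n \<le> c" unfolding n_def using LeastI[of "\<lambda>k. (1/2 :: real) ^ k \<le> c" k] k by simp
    then have "n \<noteq> 0" using c by (cases n) auto
    then obtain m where m: "n = Suc m" by (cases n) auto
    have "\<not> (1/2 :: real) ^ m \<le> c"
      using not_less_Least[of m "\<lambda>k. (1/2 :: real) ^ k \<le> c"] m by (simp add: n_def)
    then have "w \<in> V (Suc m)" if "q w \<le> c" for w
      using less[of w m] that by linarith
    then have "x \<otimes> y \<otimes> z \<in> V m" using that by (intro triple)
    then have "q (x \<otimes> y \<otimes> z) \<le> (1/2) ^ m" by (rule le)
    then show ?thesis using n m by simp
  qed
  have q_one: "q \<one> = 0"
  proof (rule antisym[OF _ nonneg])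
    have "(\<lambda>n. (1/2 :: real) ^ n) \<longlonglongrightarrow> 0"
      by (intro LIMSEQ_realpow_zero) auto
    then show "q \<one> \<le> 0"
      using le[OF one] by (auto intro: LIMSEQ_le_const)
  qed
  have q_inv: "q (inv x) = q x" if "x \<in> carrier G" for x
  proof -
    have "inv x \<in> V n \<longleftrightarrow> x \<in> V n" for n
      using inv[of x n] inv[of "inv x" n] that by auto
    then show ?thesis by (simp add: q_def)
  qed
  define R where "R x r \<longleftrightarrow> (\<exists>xs. set xs \<subseteq> carrier G \<and> list_prod xs = x \<and> sum_list (map q xs) = r)" for x r
  define p where "p x = Inf {r. R x r}" for x
  have R_single: "R x (q x)" if "x \<in> carrier G" for x
    unfolding R_def using that by (intro exI[of _ "[x]"]) simp
  have R_nonneg: "0 \<le> r" if "R x r" for x r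
    using that nonneg by (auto simp: R_def intro!: sum_list_nonneg)
  have p_le: "p x \<le> q x" if "x \<in> carrier G" for x
    unfolding p_def using R_single[OF that] R_nonneg
    by (intro cInf_lower) (auto intro: bdd_belowI[of _ 0])
  have p_ge: "q x \<le> 2 * p x" if "x \<in> carrier G" for x
  proof -
    have "q x / 2 \<le> r" if R: "R x r" for r
    proof -
      obtain xs where "set xs \<subseteq> carrier G" "list_prod xs = x" "sum_list (map q xs) = r"
        using R unfolding R_def by blast
      then show ?thesis using chain_bound[of q xs] nonneg q_one q_triple by simp
    qed
    then have "q x / 2 \<le> p x"
      unfolding p_def using R_single[OF that] by (intro cInf_greatest) auto
    then show ?thesis by simp
  qed
  have "group_seminorm G p"
    unfolding p_def
  proof (rule group_seminorm_Inf)
    show "R \<one> 0" unfolding R_def by (intro exI[of _ "[]"]) simp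
    fix x y r s assume "x \<in> carrier G" "y \<in> carrier G" "R x r" "R y s"
    then obtain xs ys where "set xs \<subseteq> carrier G" "list_prod xs = x" "sum_list (map q xs) = r"
      "set ys \<subseteq> carrier G" "list_prod ys = y" "sum_list (map q ys) = s"
      unfolding R_def by blast
    then show "R (x \<otimes> y) (r + s)"
      unfolding R_def by (intro exI[of _ "xs @ ys"]) (simp add: list_prod_append del: foldr_append)
  next
    fix x r assume "x \<in> carrier G" "R x r"
    then obtain xs where xs: "set xs \<subseteq> carrier G" "list_prod xs = x" "sum_list (map q xs) = r"
      unfolding R_def by blast
    then have "map q (map (m_inv G) xs) = map q xs" using q_inv by auto
    then show "R (inv x) r"
      unfolding R_def using xs list_prod_inv[of xs]
      by (intro exI[of _ "map (m_inv G) xs"]) (auto simp del: map_map)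
  qed (use R_single R_nonneg in blast)+
  moreover have "\<forall>x\<in>carrier G. p x \<le> 1"
    using p_le le1 order_trans by blast
  moreover have "\<forall>n. \<forall>x\<in>V n. p x \<le> (1/2) ^ n"
    using p_le le carr order_trans by (meson subsetD)
  moreover have "\<forall>n. \<forall>x\<in>carrier G. p x < (1/2) ^ Suc n \<longrightarrow> x \<in> V n"
  proof (intro allI ballI impI)
    fix n x assume x: "x \<in> carrier G" "p x < (1/2) ^ Suc n"
    then have "q x < (1/2) ^ n" using p_ge[OF x(1)] by simp
    then show "x \<in> V n" using less[of x n] anti[of n "Suc n"] by auto
  qed
  ultimately show ?thesis by (rule that)
qed

end

section \<open>Extension by a cyclic group\<close>

text \<open>Telescopes, because (n + 1) (n + 1)! = (n + 2)! - (n + 1)!.\<close>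

lemma sum_mult_fact_Suc: "(\<Sum>n<k. int (Suc n) * fact (Suc n)) = fact (Suc k) - 1"
  by (induction k) (simp_all add: algebra_simps)

lemma abs_coeff_le:
  fixes a :: "nat \<Rightarrow> int" and c :: real
  assumes "(\<Sum>n<L. \<bar>a n\<bar> / Suc n) < c" "n < L"
  shows "real_of_int \<bar>a n\<bar> < c * Suc n"
proof -
  have "\<bar>a n\<bar> / Suc n \<le> (\<Sum>n<L. \<bar>a n\<bar> / Suc n)"
    using assms(2) by (intro member_le_sum) auto
  then have "\<bar>a n\<bar> / Suc n < c" using assms(1) by simp
  then show ?thesis by (simp add: divide_simps)
qed

text \<open>The coefficients vanish from the top down. Weight below 1 forces |a n| < n + 1, so the
  terms below the top one, of index k, add up to less than (k + 1)! in absolute value and cannot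
  cancel a nonzero multiple of it.\<close>

lemma factorial_sum_eq_0:
  fixes a :: "nat \<Rightarrow> int"
  assumes "(\<Sum>n<L. \<bar>a n\<bar> / Suc n) < 1" "(\<Sum>n<L. a n * fact (Suc n)) = 0" "n < L"
  shows "a n = 0"
  using assms
proof (induction L arbitrary: n)
  case (Suc k)
  have le: "\<bar>a i\<bar> \<le> int (Suc i)" if "i < Suc k" for i

  proof -
    have "real_of_int \<bar>a i\<bar> < real_of_int (int (Suc i))"
      using abs_coeff_le[OF Suc.prems(1) that] by simp
    then show ?thesis by (simp only: of_int_less_iff less_imp_le)
  qed
  have "\<bar>a k\<bar> * fact (Suc k) = \<bar>\<Sum>i<k. a i * fact (Suc i)\<bar>"
  proof -
    have "a k * fact (Suc k) = - (\<Sum>i<k. a i * fact (Suc i))"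
      using Suc.prems(2) by simp
    then have "\<bar>a k * fact (Suc k)\<bar> = \<bar>\<Sum>i<k. a i * fact (Suc i)\<bar>" by simp
    then show ?thesis by (simp only: abs_mult abs_of_nonneg fact_ge_zero)
  qed
  also have "\<dots> \<le> (\<Sum>i<k. \<bar>a i\<bar> * fact (Suc i))"
    by (rule order_trans[OF sum_abs]) (simp only: abs_mult abs_of_nonneg fact_ge_zero order_refl)
  also have "\<dots> \<le> (\<Sum>i<k. int (Suc i) * fact (Suc i))"
    using le by (intro sum_mono mult_right_mono) auto
  also have "\<dots> < fact (Suc k)" unfolding sum_mult_fact_Suc by simp
  finally have "\<bar>a k\<bar> * fact (Suc k) < 1 * fact (Suc k)" by simp
  then have "\<bar>a k\<bar> < 1" by (rule mult_right_less_imp_less) simp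
  then have ak: "a k = 0" by simp
  show ?case
  proof (cases "n = k")
    case False
    then show ?thesis using Suc.IH[of n] Suc.prems ak by (simp add: less_Suc_eq)
  qed (use ak in simp)
qed simp

text \<open>Let m be the value of the sum. Weight below 1 / (1 + |m|) kills every coefficient with n
  \<le> |m|; the remaining factorials are divisible by (|m| + 1)!, which exceeds |m|, so m =
  0.\<close>

lemma factorial_sum_small:
  fixes a :: "nat \<Rightarrow> int"
  assumes "(\<Sum>n<L. \<bar>a n\<bar> / Suc n) < 1 / (1 + \<bar>\<Sum>n<L. a n * fact (Suc n)\<bar>)"
  shows "(\<Sum>n<L. a n * fact (Suc n)) = 0"
proof -
  define m where "m = (\<Sum>n<L. a n * fact (Suc n))"
  define M where "M = Suc (nat \<bar>m\<bar>)"
  have "fact M dvd a n * (fact (Suc n) :: int)" if n: "n < L" for n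
  proof (cases "n < M")
    case True
    have "\<bar>a n\<bar> < 1 / (1 + \<bar>m\<bar>) * Suc n"
      using abs_coeff_le[OF assms n] by (simp add: m_def)
    also have "\<dots> \<le> 1" using True by (simp add: M_def divide_le_eq) linarith
    finally have "a n = 0" by simp
    then show ?thesis by simp
  next
    case False
    then show ?thesis by (intro dvd_mult fact_dvd) simp
  qed
  then have "fact M dvd m" unfolding m_def by (intro dvd_sum) auto
  moreover have "\<bar>m\<bar> < fact M"
  proof -
    have "int M \<le> fact M" using fact_ge_self[of M] by (metis of_nat_fact of_nat_le_iff)
    then show ?thesis by (simp add: M_def)
  qed
  ultimately have "m = 0" using dvd_imp_le_int[of m "fact M"] by auto
  then show ?thesis by (simp only: m_def)
qed

locale cyclic_extension = comm_group G for G (structure) +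
  fixes p :: "'a \<Rightarrow> real" and s :: "nat \<Rightarrow> 'a"
  assumes p: "group_seminorm G p" and p_le_1: "x \<in> carrier G \<Longrightarrow> p x \<le> 1"
    and s: "s n \<in> carrier G"
begin

text \<open>The \<open>G\<close>-component of the combination of the elements
  \<open>(s n, (n + 1)!)\<close>, \<open>n < L\<close>, with coefficients
  \<open>a n\<close>.\<close>

primrec word :: "nat \<Rightarrow> (nat \<Rightarrow> int) \<Rightarrow> 'a" where
  "word 0 a = \<one>"
| "word (Suc L) a = s L [^] a L \<otimes> word L a"

lemma word_closed: "word L a \<in> carrier G"
  by (induction L) (auto simp: s)

lemma word_add: "word L (\<lambda>n. a n + b n) = word L a \<otimes> word L b"
  by (induction L) (auto simp: word_closed s int_pow_mult m_ac)

lemma word_minus: "word L (\<lambda>n. - a n) = inv (word L a)"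
  by (induction L) (auto simp: word_closed s int_pow_neg inv_mult)

lemma word_zero: "(\<And>n. n < L \<Longrightarrow> a n = 0) \<Longrightarrow> word L a = \<one>"
  by (induction L) auto

lemma word_extend: "\<lbrakk>L \<le> L'; \<And>n. n \<ge> L \<Longrightarrow> a n = 0\<rbrakk> \<Longrightarrow> word L' a = word L a"
  by (induction L' rule: dec_induct) (auto simp: word_closed)

text \<open>
  In the extension \<open>G \<times> \<int>\<close>, the elements \<open>(s n, (n + 1)!)\<close> get weight \<open>1 / (n + 1)\<close> and the
  elements \<open>(h, 0)\<close> get weight \<open>p h\<close>; a representation writes \<open>x\<close> as a combination of total
  weight at most \<open>r\<close>.
\<close>

definition rep_at :: "nat \<Rightarrow> 'a \<Rightarrow> (nat \<Rightarrow> int) \<Rightarrow> 'a \<times> int \<Rightarrow> real \<Rightarrow> bool" where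
  "rep_at L h a x r \<longleftrightarrow> h \<in> carrier G \<and> (\<forall>n\<ge>L. a n = 0) \<and> fst x = h \<otimes> word L a \<and>
     snd x = (\<Sum>n<L. a n * fact (Suc n)) \<and> p h + (\<Sum>n<L. \<bar>a n\<bar> / Suc n) \<le> r"

definition rep :: "'a \<times> int \<Rightarrow> real \<Rightarrow> bool" where
  "rep x r \<longleftrightarrow> (\<exists>L h a. rep_at L h a x r)"

definition ext :: "'a \<times> int \<Rightarrow> real" where
  "ext x = Inf {r. rep x r}"

text \<open>Padding with zero coefficients brings two representations to a common length before
  \<open>rep_mult\<close> adds them.\<close>

lemma rep_at_mono:
  assumes "rep_at L h a x r" "L \<le> L'"
  shows "rep_at L' h a x r"
proof -
  have "(\<Sum>n<L'. a n * fact (Suc n)) = (\<Sum>n<L. a n * fact (Suc n))"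
    using assms by (intro sum.mono_neutral_right) (auto simp: rep_at_def)
  moreover have "(\<Sum>n<L'. \<bar>a n\<bar> / Suc n) = (\<Sum>n<L. \<bar>a n\<bar> / Suc n)"
    using assms by (intro sum.mono_neutral_right) (auto simp: rep_at_def)
  ultimately show ?thesis
    using assms word_extend[of L L' a] by (simp add: rep_at_def)
qed

lemma p_one: "p \<one> = 0"
  and p_nonneg: "x \<in> carrier G \<Longrightarrow> 0 \<le> p x"
  and p_inv: "x \<in> carrier G \<Longrightarrow> p (inv x) = p x"
  and p_mult: "\<lbrakk>x \<in> carrier G; y \<in> carrier G\<rbrakk> \<Longrightarrow> p (x \<otimes> y) \<le> p x + p y"
  using p by (auto simp: group_seminorm_def)

lemma rep_nonneg:
  assumes "rep x r"
  shows "0 \<le> r"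
proof -
  obtain L h a where "rep_at L h a x r" using assms unfolding rep_def by blast
  moreover have "0 \<le> (\<Sum>n<L. \<bar>a n\<bar> / Suc n)" by (intro sum_nonneg) auto
  ultimately show ?thesis using p_nonneg[of h] by (simp add: rep_at_def)
qed

lemma rep_Pair_0: "g \<in> carrier G \<Longrightarrow> rep (g, 0) (p g)"
  unfolding rep_def rep_at_def by (intro exI[of _ 0] exI[of _ g] exI[of _ "\<lambda>_. 0"]) auto

lemma rep_mult:
  assumes "rep x r" "rep y t"
  shows "rep (x \<otimes>\<^bsub>G \<times>\<times> integer_group\<^esub> y) (r + t)"
proof -
  obtain L h a L' h' b where "rep_at L h a x r" "rep_at L' h' b y t"
    using assms unfolding rep_def by blast
  then have a: "rep_at (max L L') h a x r" and b: "rep_at (max L L') h' b y t"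
    by (auto intro: rep_at_mono)
  define M where "M = max L L'"
  have "(\<Sum>n<M. \<bar>a n + b n\<bar> / Suc n) \<le> (\<Sum>n<M. \<bar>a n\<bar> / Suc n + \<bar>b n\<bar> / Suc n)"
    by (intro sum_mono) (simp add: divide_simps)
  then have "rep_at M (h \<otimes> h') (\<lambda>n. a n + b n) (x \<otimes>\<^bsub>G \<times>\<times> integer_group\<^esub> y) (r + t)"
    using a b p_mult[of h h'] unfolding rep_at_def M_def[symmetric]
    by (cases x, cases y) (auto simp: word_add word_closed m_ac sum.distrib algebra_simps)
  then show ?thesis unfolding rep_def by blast
qed

lemma rep_inv:
  assumes "x \<in> carrier (G \<times>\<times> integer_group)" "rep x r"
  shows "rep (inv\<^bsub>G \<times>\<times> integer_group\<^esub> x) r"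
proof -
  obtain L h a where "rep_at L h a x r"
    using assms unfolding rep_def by blast
  then have "rep_at L (inv h) (\<lambda>n. - a n) (inv\<^bsub>G \<times>\<times> integer_group\<^esub> x) r"
    using p_inv[of h] assms(1) unfolding rep_at_def
    by (cases x) (auto simp: inv_DirProd[OF group_axioms group_integer_group] inv_integer_group
        word_minus word_closed inv_mult sum_negf)
  then show ?thesis unfolding rep_def by blast
qed

lemma rep_exists: "g \<in> carrier G \<Longrightarrow> \<exists>r. rep (g, m) r"
proof -
  assume g: "g \<in> carrier G"
  \<comment> \<open>Since 1! = 1, taking \<open>(s 0, 1!)\<close> with coefficient \<open>m\<close>
    already gives the right integer component; \<open>h\<close> corrects the rest.\<close>
  let ?a = "\<lambda>n. if n = 0 then m else (0::int)"
  have "rep_at 1 (g \<otimes> inv (s 0 [^] m)) ?a (g, m) (p (g \<otimes> inv (s 0 [^] m)) + \<bar>m\<bar>)"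
    using g s by (auto simp: rep_at_def m_assoc)
  then show ?thesis unfolding rep_def by blast
qed

lemma group_seminorm_ext: "group_seminorm (G \<times>\<times> integer_group) ext"
proof -
  interpret H: group "G \<times>\<times> integer_group"
    by (intro DirProd_group group_axioms group_integer_group)
  show ?thesis
    unfolding ext_def
  proof (rule H.group_seminorm_Inf)
    show "rep \<one>\<^bsub>G \<times>\<times> integer_group\<^esub> 0"
      using rep_Pair_0[of \<one>] p_one by simp
  qed (use rep_nonneg rep_mult rep_inv rep_exists in auto)
qed

lemma ext_le: "rep x r \<Longrightarrow> ext x \<le> r"
  unfolding ext_def by (intro cInf_lower) (auto intro: bdd_belowI[of _ 0] rep_nonneg)

lemma ext_less_iff: "x \<in> carrier (G \<times>\<times> integer_group) \<Longrightarrow> ext x < c \<longleftrightarrow> (\<exists>r<c. rep x r)"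
  unfolding ext_def using rep_exists[of "fst x" "snd x"]
  by (subst cInf_less_iff) (auto intro: bdd_belowI[of _ 0] rep_nonneg)

lemma ext_Pair_0: "g \<in> carrier G \<Longrightarrow> ext (g, 0) = p g"
proof (rule antisym)
  assume g: "g \<in> carrier G"
  show "ext (g, 0) \<le> p g" using rep_Pair_0[OF g] by (rule ext_le)
  show "p g \<le> ext (g, 0)"
  proof (rule ccontr)
    assume "\<not> p g \<le> ext (g, 0)"
    then obtain r where r: "r < p g" "rep (g, 0) r"
      using ext_less_iff[of "(g, 0)" "p g"] g by auto
    then obtain L h a where a: "rep_at L h a (g, 0) r" unfolding rep_def by blast
    then have h: "h \<in> carrier G" "g = h \<otimes> word L a" "(\<Sum>n<L. a n * fact (Suc n)) = 0"
      "p h + (\<Sum>n<L. \<bar>a n\<bar> / Suc n) \<le> r"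
      by (simp_all add: rep_at_def del: fact_Suc)
    have "0 \<le> (\<Sum>n<L. \<bar>a n\<bar> / Suc n)" by (intro sum_nonneg) auto
    \<comment> \<open>Here \<open>p \<le> 1\<close> enters: a cost below \<open>p g\<close> leaves
      weight below 1 for the coefficients, as \<open>factorial_sum_eq_0\<close> requires.\<close>
    then have less: "p h < p g" "(\<Sum>n<L. \<bar>a n\<bar> / Suc n) < 1"
      using h(4) r(1) p_le_1[OF g] p_nonneg[OF h(1)] by linarith+
    have "word L a = \<one>"
      by (intro word_zero factorial_sum_eq_0[OF less(2) h(3)])
    then have "g = h" using h(1,2) by simp
    then show False using less(1) by simp
  qed
qed

text \<open>A cost below 1 / (1 + |m|) would make the integer component vanish by
  \<open>factorial_sum_small\<close>. This separates points outside G \<times> {0} from the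
  identity.\<close>

lemma ext_pos:
  assumes "g \<in> carrier G" "m \<noteq> 0"
  shows "0 < ext (g, m)"
proof (rule ccontr)
  assume "\<not> 0 < ext (g, m)"
  moreover have "(0 :: real) < 1 / (1 + \<bar>m\<bar>)" by simp
  ultimately have "ext (g, m) < 1 / (1 + \<bar>m\<bar>)" by linarith
  then obtain r where r: "r < 1 / (1 + \<bar>m\<bar>)" "rep (g, m) r"
    using ext_less_iff[of "(g, m)"] assms by auto
  then obtain L h a where "rep_at L h a (g, m) r" unfolding rep_def by blast
  then have h: "h \<in> carrier G" "m = (\<Sum>n<L. a n * fact (Suc n))"
    "p h + (\<Sum>n<L. \<bar>a n\<bar> / Suc n) \<le> r"
    by (simp_all add: rep_at_def del: fact_Suc)
  then have "(\<Sum>n<L. \<bar>a n\<bar> / Suc n) < 1 / (1 + \<bar>\<Sum>n<L. a n * fact (Suc n)\<bar>)"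
    using r p_nonneg[of h] by (simp del: fact_Suc)
  then have "m = 0" using factorial_sum_small[of a L] h(2) by (simp del: fact_Suc)
  then show False using assms by simp
qed

text \<open>Additively, (g, (n + 1)!) = (g - s n, 0) + (s n, (n + 1)!). Both costs are small when
  \<open>s n\<close> is near \<open>g\<close> and \<open>n\<close> is large; density of \<int> rests
  on this.\<close>

lemma ext_fact_le:
  assumes "g \<in> carrier G"
  shows "ext (g, fact (Suc n)) \<le> p (g \<otimes> inv (s n)) + 1 / Suc n"
proof (rule ext_le)
  let ?a = "\<lambda>k. if k = n then 1 else (0::int)"
  have "word (Suc n) ?a = s n"
    using word_zero[of n ?a] s by (simp)
  moreover have "(\<Sum>k<Suc n. ?a k * fact (Suc k)) = fact (Suc n)"
    by (simp del: fact_Suc)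
  moreover have "(\<Sum>k<Suc n. \<bar>?a k\<bar> / Suc k) = 1 / Suc n"
    by simp
  ultimately have "rep_at (Suc n) (g \<otimes> inv (s n)) ?a (g, fact (Suc n)) (p (g \<otimes> inv (s n)) + 1 / Suc n)"
    unfolding rep_at_def using assms s by (simp add: m_assoc del: fact_Suc sum.lessThan_Suc)
  then show "rep (g, fact (Suc n)) (p (g \<otimes> inv (s n)) + 1 / Suc n)"
    unfolding rep_def by blast
qed

end

section \<open>Subgroups of monothetic groups\<close>

locale topgroup = group G for G (structure) +
  fixes T :: "'a topology"
  assumes topological_group: "topological_group G T"
begin

lemma topspace_eq: "topspace T = carrier G"
  and Hausdorff: "Hausdorff_space T"
  and continuous_mult: "continuous_map (prod_topology T T) T (\<lambda>(x, y). x \<otimes> y)"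
  and continuous_inv: "continuous_map T T (\<lambda>x. inv x)"
  using topological_group by (auto simp: topological_group_def)

lemma open_subset: "openin T U \<Longrightarrow> U \<subseteq> carrier G"
  using openin_subset topspace_eq by blast

lemma continuous_map_mult:
  assumes "continuous_map X T f" "continuous_map X T h"
  shows "continuous_map X T (\<lambda>x. f x \<otimes> h x)"
proof -
  have "continuous_map X (prod_topology T T) (\<lambda>x. (f x, h x))"
    using assms by (simp add: continuous_map_pairwise o_def)
  from continuous_map_compose[OF this continuous_mult] show ?thesis
    by (simp add: o_def)
qed

lemma continuous_map_const': "a \<in> carrier G \<Longrightarrow> continuous_map X T (\<lambda>x. a)"
  by (simp add: topspace_eq)

lemma openin_preimage:
  "\<lbrakk>continuous_map T T f; openin T U\<rbrakk> \<Longrightarrow> openin T {x \<in> carrier G. f x \<in> U}"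
  using openin_continuous_map_preimage[of T T f U] by (simp add: topspace_eq)

lemma openin_right_translate:
  "\<lbrakk>openin T U; a \<in> carrier G\<rbrakk> \<Longrightarrow> openin T {x \<in> carrier G. x \<otimes> a \<in> U}"
  by (intro openin_preimage continuous_map_mult continuous_map_const' continuous_map_id[unfolded id_def]) auto

lemma openin_carrier: "openin T (carrier G)"
  using openin_topspace[of T] by (simp add: topspace_eq)

lemma mult_nbhds:
  assumes "openin T U" "x \<in> carrier G" "y \<in> carrier G" "x \<otimes> y \<in> U"
  obtains V W where "openin T V" "openin T W" "x \<in> V" "y \<in> W" "\<And>v w. \<lbrakk>v \<in> V; w \<in> W\<rbrakk> \<Longrightarrow> v \<otimes> w \<in> U"
proof -
  define P where "P = {z \<in> topspace (prod_topology T T). (case z of (x, y) \<Rightarrow> x \<otimes> y) \<in> U}"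
  have "openin (prod_topology T T) P"
    unfolding P_def by (rule openin_continuous_map_preimage[OF continuous_mult assms(1)])
  moreover have "(x, y) \<in> P" using assms by (simp add: P_def topspace_eq)
  ultimately have "\<exists>V W. openin T V \<and> openin T W \<and> x \<in> V \<and> y \<in> W \<and> V \<times> W \<subseteq> P"
    unfolding openin_prod_topology_alt by blast
  then obtain V W where VW: "openin T V" "openin T W" "x \<in> V" "y \<in> W" "V \<times> W \<subseteq> P"
    by blast
  have "v \<otimes> w \<in> U" if "v \<in> V" "w \<in> W" for v w
    using VW(5) that unfolding P_def by auto
  then show ?thesis by (rule that[OF VW(1-4)])
qed

lemma symmetric_nbhd_triple:
  assumes "openin T U" "\<one> \<in> U"
  obtains V where "openin T V" "\<one> \<in> V" "V \<subseteq> U" "\<forall>x\<in>V. inv x \<in> V"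
    "\<forall>x\<in>V. \<forall>y\<in>V. \<forall>z\<in>V. x \<otimes> y \<otimes> z \<in> U"
proof -
  obtain V1 W1 where 1: "openin T V1" "openin T W1" "\<one> \<in> V1" "\<one> \<in> W1"
    "\<And>v w. \<lbrakk>v \<in> V1; w \<in> W1\<rbrakk> \<Longrightarrow> v \<otimes> w \<in> U"
    using mult_nbhds[OF assms(1), of \<one> \<one>] assms(2) by auto
  obtain V2 W2 where 2: "openin T V2" "openin T W2" "\<one> \<in> V2" "\<one> \<in> W2"
    "\<And>v w. \<lbrakk>v \<in> V2; w \<in> W2\<rbrakk> \<Longrightarrow> v \<otimes> w \<in> V1"
    using mult_nbhds[OF 1(1), of \<one> \<one>] 1 by auto
  \<comment> \<open>\<open>V2 \<inter> W2\<close> puts the product of the first two factors into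
    \<open>V1\<close>, \<open>W1\<close> takes the third, and \<open>U\<close> gives the
    inclusion.\<close>
  define W where "W = V2 \<inter> W2 \<inter> W1 \<inter> U"
  define V where "V = W \<inter> {x \<in> carrier G. inv x \<in> W}"
  have W: "openin T W" "\<one> \<in> W" using 1 2 assms by (auto simp: W_def)
  show ?thesis
  proof (rule that)
    show "openin T V" using W by (auto simp: V_def intro: openin_preimage continuous_inv)
    show "\<one> \<in> V" using W by (simp add: V_def)
    show "V \<subseteq> U" by (auto simp: V_def W_def)
    show "\<forall>x\<in>V. inv x \<in> V" by (auto simp: V_def)
    show "\<forall>x\<in>V. \<forall>y\<in>V. \<forall>z\<in>V. x \<otimes> y \<otimes> z \<in> U"
      using 1(5) 2(5) by (simp add: V_def W_def)
  qed
qed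

text \<open>If \<open>z\<close> is in the closure of \<open>V\<close>, the neighbourhood of
  \<open>z\<close> formed by all \<open>y\<close> with \<open>inv y \<otimes> z \<in> W\<close>
  meets \<open>V\<close> in some \<open>v\<close>, and
  \<open>z = v \<otimes> (inv v \<otimes> z)\<close> is a product of elements of \<open>V\<close>
  and \<open>W\<close>.\<close>

lemma regular_nbhd:
  assumes "openin T U" "x \<in> U"
  shows "\<exists>V. openin T V \<and> x \<in> V \<and> T closure_of V \<subseteq> U"
proof -
  have x: "x \<in> carrier G" using assms open_subset by blast
  obtain V W where VW: "openin T V" "openin T W" "x \<in> V" "\<one> \<in> W" "\<And>v w. \<lbrakk>v \<in> V; w \<in> W\<rbrakk> \<Longrightarrow> v \<otimes> w \<in> U"
    using mult_nbhds[OF assms(1) x, of \<one>] x assms by auto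
  have "z \<in> U" if z: "z \<in> T closure_of V" for z
  proof -
    have zc: "z \<in> carrier G" using z in_closure_of topspace_eq by fastforce
    let ?O = "{y \<in> carrier G. inv y \<otimes> z \<in> W}"
    have open_O: "openin T ?O"
      using VW(2) zc by (intro openin_preimage continuous_map_mult continuous_inv continuous_map_const')
    have z_O: "z \<in> ?O" using zc VW(4) by simp
    have "\<exists>y. y \<in> V \<and> y \<in> N" if "openin T N" "z \<in> N" for N
      using z that by (simp add: in_closure_of)
    from this[OF open_O z_O] obtain v where "v \<in> V" "v \<in> ?O" by (elim exE conjE)
    then have "v \<otimes> (inv v \<otimes> z) \<in> U" using VW(5) by simp
    then show ?thesis using zc \<open>v \<in> ?O\<close> by (simp add: m_assoc[symmetric])
  qed
  then show ?thesis using VW by blast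
qed

text \<open>Continuous maps into a Hausdorff space that agree on \<open>D\<close> agree on its
  closure. This is applied twice: first with one factor fixed in \<open>D\<close>, then with that
  factor replaced by an arbitrary \<open>b\<close>.\<close>

lemma commute_if_dense_commute:
  assumes D: "T closure_of D = topspace T" "D \<subseteq> carrier G"
    and comm: "\<And>a b. \<lbrakk>a \<in> D; b \<in> D\<rbrakk> \<Longrightarrow> a \<otimes> b = b \<otimes> a"
    and ab: "a \<in> carrier G" "b \<in> carrier G"
  shows "a \<otimes> b = b \<otimes> a"
proof -
  have step: "y \<otimes> c = c \<otimes> y"
    if "c \<in> carrier G" "y \<in> carrier G" "\<And>d. d \<in> D \<Longrightarrow> d \<otimes> c = c \<otimes> d" for c y
  proof (rule forall_in_closure_of_eq[where X = T and Y = T and S = D and f = "\<lambda>y. y \<otimes> c" and g = "\<lambda>y. c \<otimes> y"])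
    show "y \<in> T closure_of D" using D that topspace_eq by simp
    show "continuous_map T T (\<lambda>y. y \<otimes> c)" "continuous_map T T (\<lambda>y. c \<otimes> y)"
      using that by (intro continuous_map_mult continuous_map_const' continuous_map_id[unfolded id_def]; simp)+
  qed (use Hausdorff that in auto)
  have "b \<otimes> d = d \<otimes> b" if "d \<in> D" for d
    using step[of d b] comm that D ab by blast
  then show ?thesis using step[of b a] ab by simp
qed

text \<open>In a regular space the sets \<open>int (cl A)\<close>, for \<open>A\<close> ranging over the subsets of a dense set, form a base.\<close>

lemma base_of_dense_sequence:
  fixes e :: "nat \<Rightarrow> 'a"
  assumes "T closure_of (range e) = topspace T"
  shows "base_of T (range (\<lambda>b :: nat \<Rightarrow> bool. T interior_of (T closure_of (e ` {n. b n}))))"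
  unfolding base_of_def
proof (intro conjI allI impI)
  fix U x assume U: "openin T U \<and> x \<in> U"
  then obtain V where V: "openin T V" "x \<in> V" "T closure_of V \<subseteq> U"
    using regular_nbhd by blast
  \<comment> \<open>The index records the trace of \<open>V\<close> on the sequence; an open set and
    its trace on a dense set have the same closure.\<close>
  let ?b = "\<lambda>n. e n \<in> V"
  have "e ` {n. ?b n} = V \<inter> range e" by auto
  then have "T closure_of (e ` {n. ?b n}) = T closure_of V"
    using closure_of_openin_Int_superset[of T V "range e"] V(1) assms openin_subset[OF V(1)] by simp
  moreover have "V \<subseteq> T interior_of (T closure_of V)"
    using V(1) by (simp add: interior_of_maximal closure_of_subset openin_subset)
  moreover have "T interior_of (T closure_of V) \<subseteq> U"
    using V(3) interior_of_subset[of T "T closure_of V"] by simp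
  ultimately show "\<exists>V\<in>range (\<lambda>b. T interior_of (T closure_of (e ` {n. b n}))). x \<in> V \<and> V \<subseteq> U"
    using V(2) by (intro bexI[OF _ rangeI[of _ ?b]]) auto
qed auto

lemma dense_sequence_if_monothetic:
  assumes "monothetic G T"
  obtains e :: "nat \<Rightarrow> 'a" where "T closure_of (range e) = topspace T" "range e \<subseteq> carrier G"
    "\<And>m n. e m \<otimes> e n = e n \<otimes> e m"
proof -
  obtain x where x: "x \<in> carrier G" "T closure_of (generate G {x}) = topspace T"
    using assms by (auto simp: monothetic_def)
  define e :: "nat \<Rightarrow> 'a" where "e n = x [^] int_decode n" for n
  have "range e = range (\<lambda>k::int. x [^] k)"
    using image_image[of "\<lambda>k::int. x [^] k" int_decode UNIV] by (simp add: e_def surj_int_decode)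
  then have "generate G {x} = range e" using generate_pow[OF x(1)] by auto
  moreover have "e m \<otimes> e n = e n \<otimes> e m" for m n
    using x(1) by (simp add: e_def int_pow_mult[symmetric] add.commute)
  moreover have "range e \<subseteq> carrier G" using x(1) by (auto simp: e_def)
  ultimately show ?thesis using that x(2) by auto
qed

end

section \<open>Properties inherited by subgroups of monothetic groups\<close>

lemma continuum_eq: "(continuum :: (nat \<Rightarrow> bool) rel) = |UNIV|"
  by (simp add: cexp_def ctwo_def Field_natLeq Field_card_of Func_def)

text \<open>Trades the isomorphism onto a subgroup for an injective homomorphism inducing the
  topology \<open>T\<close>, along which properties of \<open>H\<close> can be pulled back.\<close>

lemma topological_subgroup_embedding:
  assumes tg: "topological_group G T" "topological_group H S" and "iso_to_topological_subgroup G T H S"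
  obtains f where "f \<in> hom G H" "inj_on f (carrier G)"
    "\<And>U. openin T U \<longleftrightarrow> (\<exists>W. openin S W \<and> U = {g \<in> carrier G. f g \<in> W})"
proof -
  obtain K f where K: "subgroup K H" and iso: "f \<in> iso G (H\<lparr>carrier := K\<rparr>)"
    and hm: "homeomorphic_map T (subtopology S K) f"
    using assms(3) by (auto simp: iso_to_topological_subgroup_def topological_group_iso_def)
  have KH: "K \<subseteq> carrier H" using K by (rule subgroup.subset)
  have tops: "topspace T = carrier G" using tg by (simp add: topological_group_def)
  have bij: "bij_betw f (carrier G) K" using iso by (simp add: iso_def)
  have "f \<in> hom G H" using iso KH by (auto simp: iso_def hom_def)
  moreover have inj: "inj_on f (carrier G)" using bij by (simp add: bij_betw_def)
  moreover have "openin T U \<longleftrightarrow> (\<exists>W. openin S W \<and> U = {g \<in> carrier G. f g \<in> W})" for U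
  proof
    assume U: "openin T U"
    then have "openin (subtopology S K) (f ` U)" "U \<subseteq> carrier G"
      using homeomorphic_map_openness_eq[OF hm, of U] tops by auto
    then obtain W where W: "openin S W" "f ` U = W \<inter> K" by (auto simp: openin_subtopology)
    have "U = {g \<in> carrier G. f g \<in> W}"
    proof
      show "U \<subseteq> {g \<in> carrier G. f g \<in> W}" using W \<open>U \<subseteq> carrier G\<close> by blast
      show "{g \<in> carrier G. f g \<in> W} \<subseteq> U"
      proof
        fix g assume "g \<in> {g \<in> carrier G. f g \<in> W}"
        then have g: "g \<in> carrier G" "f g \<in> W \<inter> K" using bij bij_betwE by auto
        then obtain u where "u \<in> U" "f g = f u" using W(2) by (metis imageE)
        then show "g \<in> U" using inj g(1) \<open>U \<subseteq> carrier G\<close> by (metis inj_onD subsetD)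
      qed
    qed
    then show "\<exists>W. openin S W \<and> U = {g \<in> carrier G. f g \<in> W}" using W(1) by blast
  next
    assume "\<exists>W. openin S W \<and> U = {g \<in> carrier G. f g \<in> W}"
    then obtain W where W: "openin S W" "U = {g \<in> carrier G. f g \<in> W}" by blast
    have "continuous_map T S f"
      using homeomorphic_imp_continuous_map[OF hm] by (simp add: continuous_map_in_subtopology)
    then show "openin T U"
      using openin_continuous_map_preimage[of T S f W] W tops by simp
  qed
  ultimately show ?thesis by (rule that)
qed

lemma embeds_in_monothetic_group_imp:
  assumes tg: "topological_group G T" and emb: "embeds_in_monothetic_group G T"
  shows "comm_group G \<and> aleph0_bounded G T \<and> weight T \<le>o continuum"
proof -
  obtain H :: "nat set set monoid" and S where H: "topological_group H S" "monothetic H S"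
    and iso: "iso_to_topological_subgroup G T H S"
    using emb unfolding embeds_in_monothetic_group_def by blast
  interpret H: topgroup H S
    by (rule topgroup.intro) (use H(1) in \<open>auto simp: topological_group_def topgroup_axioms_def\<close>)
  interpret G: topgroup G T
    by (rule topgroup.intro) (use tg in \<open>auto simp: topological_group_def topgroup_axioms_def\<close>)
  obtain f where hom: "f \<in> hom G H" and inj: "inj_on f (carrier G)"
    and open_iff: "\<And>U. openin T U \<longleftrightarrow> (\<exists>W. openin S W \<and> U = {g \<in> carrier G. f g \<in> W})"
    using topological_subgroup_embedding[OF tg H(1) iso] by blast
  interpret f: group_hom G H f
    by unfold_locales (use hom in simp)
  obtain e :: "nat \<Rightarrow> _" where e: "S closure_of (range e) = topspace S" "range e \<subseteq> carrier H"
    "\<And>m n. e m \<otimes>\<^bsub>H\<^esub> e n = e n \<otimes>\<^bsub>H\<^esub> e m"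
    using H.dense_sequence_if_monothetic[OF H(2)] by blast
  have comm: "a \<otimes>\<^bsub>H\<^esub> b = b \<otimes>\<^bsub>H\<^esub> a" if "a \<in> carrier H" "b \<in> carrier H" for a b
    using H.commute_if_dense_commute[OF e(1,2) _ that] e(3) by blast
  interpret H: comm_group H
    by (rule H.group_comm_groupI) (rule comm)
  have "comm_group G"
  proof (rule G.group_comm_groupI)
    fix x y assume xy: "x \<in> carrier G" "y \<in> carrier G"
    then have "f (x \<otimes>\<^bsub>G\<^esub> y) = f (y \<otimes>\<^bsub>G\<^esub> x)" by (simp add: comm)
    then show "x \<otimes>\<^bsub>G\<^esub> y = y \<otimes>\<^bsub>G\<^esub> x" by (rule inj_onD[OF inj]) (use xy in simp_all)
  qed
  moreover have "aleph0_bounded G T"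
    unfolding aleph0_bounded_def
  proof (intro allI impI, elim conjE)
    fix U assume U: "openin T U" "U \<noteq> {}"
    then obtain u where u: "u \<in> U" by blast
    obtain W where W: "openin S W" "U = {g \<in> carrier G. f g \<in> W}" using U open_iff by blast
    have uG: "u \<in> carrier G" and fu: "f u \<in> carrier H" using u W by auto
    \<comment> \<open>\<open>U\<close> need not contain the identity; translating by
      \<open>f u\<close> reduces to a neighbourhood of it.\<close>
    let ?W = "{x \<in> carrier H. x \<otimes>\<^bsub>H\<^esub> f u \<in> W}"
    have W': "openin S ?W" using W(1) fu by (rule H.openin_right_translate)
    have one_W': "\<one>\<^bsub>H\<^esub> \<in> ?W" using W fu u by simp
    obtain V where V: "openin S V" "\<one>\<^bsub>H\<^esub> \<in> V" "V \<subseteq> ?W" "\<forall>x\<in>V. inv\<^bsub>H\<^esub> x \<in> V"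
      "\<forall>x\<in>V. \<forall>y\<in>V. \<forall>z\<in>V. x \<otimes>\<^bsub>H\<^esub> y \<otimes>\<^bsub>H\<^esub> z \<in> ?W"
      by (rule H.symmetric_nbhd_triple[OF W' one_W'])
    \<comment> \<open>\<open>P n g\<close> means that \<open>f g\<close> lies in the translate of
      \<open>V\<close> by \<open>e n\<close>. The points \<open>e n\<close> may lie outside the
      image of \<open>G\<close>, so each translate that meets the image is represented by a chosen
      \<open>c n\<close> in \<open>G\<close>.\<close>
    define P where "P n g \<longleftrightarrow> g \<in> carrier G \<and> inv\<^bsub>H\<^esub> (e n) \<otimes>\<^bsub>H\<^esub> f g \<in> V" for n g
    define c where "c n = (SOME g. P n g)" for n
    define C where "C = (\<lambda>n. c n \<otimes>\<^bsub>G\<^esub> inv\<^bsub>G\<^esub> u) ` {n. \<exists>g. P n g}"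
    have c: "P n (c n)" if "P n g" for n g
      unfolding c_def using that by (rule someI)
    have eH: "e n \<in> carrier H" for n using e(2) by blast
    have C: "C \<subseteq> carrier G" using c uG by (auto simp: C_def P_def)
    have "\<exists>k\<in>C. g \<in> k <#\<^bsub>G\<^esub> U" if g: "g \<in> carrier G" for g
    proof -
      have fg: "f g \<in> carrier H" using g by simp
      \<comment> \<open>Density puts some \<open>e n\<close> into the translate of \<open>V\<close>
        by \<open>f g\<close>; symmetry of \<open>V\<close> and commutativity reverse the
        roles.\<close>
      let ?O = "{y \<in> carrier H. y \<otimes>\<^bsub>H\<^esub> inv\<^bsub>H\<^esub> (f g) \<in> V}"
      have "openin S ?O" using V(1) fg by (intro H.openin_right_translate) simp_all
      moreover have "?O \<noteq> {}" using V(2) fg by force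
      ultimately have "range e \<inter> ?O \<noteq> {}" using e(1) unfolding dense_intersects_open by simp
      then obtain n where "e n \<otimes>\<^bsub>H\<^esub> inv\<^bsub>H\<^esub> (f g) \<in> V" by auto
      then have "inv\<^bsub>H\<^esub> (e n \<otimes>\<^bsub>H\<^esub> inv\<^bsub>H\<^esub> (f g)) \<in> V" by (rule V(4)[rule_format])
      then have Pg: "P n g" using g fg eH by (simp add: P_def H.inv_mult)
      then have Pc: "P n (c n)" by (rule c)
      have cG: "c n \<in> carrier G" using Pc by (simp add: P_def)
      let ?y = "u \<otimes>\<^bsub>G\<^esub> (inv\<^bsub>G\<^esub> (c n) \<otimes>\<^bsub>G\<^esub> g)"
      let ?a = "inv\<^bsub>H\<^esub> (e n) \<otimes>\<^bsub>H\<^esub> f (c n)" and ?b = "inv\<^bsub>H\<^esub> (e n) \<otimes>\<^bsub>H\<^esub> f g"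
      have ab: "?a \<in> V" "?b \<in> V" using Pg Pc by (simp_all add: P_def)
      have "inv\<^bsub>H\<^esub> ?a \<otimes>\<^bsub>H\<^esub> ?b = inv\<^bsub>H\<^esub> (f (c n)) \<otimes>\<^bsub>H\<^esub> (e n \<otimes>\<^bsub>H\<^esub> (inv\<^bsub>H\<^esub> (e n) \<otimes>\<^bsub>H\<^esub> f g))"
        using eH cG fg by (simp add: H.inv_mult_group H.m_assoc)
      also have "\<dots> = inv\<^bsub>H\<^esub> (f (c n)) \<otimes>\<^bsub>H\<^esub> f g"
        using eH[of n] fg by (simp add: H.m_assoc[symmetric])
      \<comment> \<open>\<open>f (c n)\<close> and \<open>f g\<close> lie in the same translate of
        \<open>V\<close>, so their quotient is a product of two elements of \<open>V\<close>; the
        identity serves as third factor.\<close>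
      finally have "inv\<^bsub>H\<^esub> (f (c n)) \<otimes>\<^bsub>H\<^esub> f g \<in> ?W"
        using V(5)[rule_format, OF V(4)[rule_format, OF ab(1)] ab(2) V(2)] cG fg by simp
      then have "f ?y \<in> W" using uG cG g fu by (simp add: comm)
      then have "?y \<in> U" using W uG cG g by simp
      moreover have "g = (c n \<otimes>\<^bsub>G\<^esub> inv\<^bsub>G\<^esub> u) \<otimes>\<^bsub>G\<^esub> ?y"
      proof -
        have "inv\<^bsub>G\<^esub> u \<otimes>\<^bsub>G\<^esub> (u \<otimes>\<^bsub>G\<^esub> (inv\<^bsub>G\<^esub> (c n) \<otimes>\<^bsub>G\<^esub> g)) = inv\<^bsub>G\<^esub> (c n) \<otimes>\<^bsub>G\<^esub> g"
          using uG cG g by (simp add: G.m_assoc[symmetric])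
        then show ?thesis using uG cG g by (simp add: G.m_assoc) (simp add: G.m_assoc[symmetric])
      qed
      moreover have "c n \<otimes>\<^bsub>G\<^esub> inv\<^bsub>G\<^esub> u \<in> C" using Pg by (auto simp: C_def)
      ultimately show ?thesis unfolding l_coset_def by blast
    qed
    moreover have "k <#\<^bsub>G\<^esub> U \<subseteq> carrier G" if "k \<in> C" for k
      using that C G.open_subset[OF U(1)] by (auto simp: l_coset_def)
    ultimately have "carrier G = (\<Union>k\<in>C. k <#\<^bsub>G\<^esub> U)" by blast
    then show "\<exists>C. C \<subseteq> carrier G \<and> countable C \<and> carrier G = (\<Union>c\<in>C. c <#\<^bsub>G\<^esub> U)"
      using C by (intro exI[of _ C]) (auto simp: C_def)
  qed
  moreover have "weight T \<le>o continuum"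
  proof -
    define B where "B = (\<lambda>b :: nat \<Rightarrow> bool. S interior_of (S closure_of (e ` {n. b n})))"
    have B: "base_of S (range B)" unfolding B_def by (rule H.base_of_dense_sequence[OF e(1)])
    define A where "A b = {g \<in> carrier G. f g \<in> B b}" for b
    have "base_of T (range A)"
      unfolding base_of_def
    proof (intro conjI allI impI ballI)
      fix V assume "V \<in> range A"
      then show "openin T V" using B open_iff unfolding A_def base_of_def by blast
    next
      fix U x assume "openin T U \<and> x \<in> U"
      then obtain W where W: "openin S W" "U = {g \<in> carrier G. f g \<in> W}" "x \<in> U" using open_iff by blast
      then have "f x \<in> W" by simp
      then have "\<exists>V\<in>range B. f x \<in> V \<and> V \<subseteq> W" using B W(1) unfolding base_of_def by blast
      then obtain b where "f x \<in> B b" "B b \<subseteq> W" by blast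
      then show "\<exists>V\<in>range A. x \<in> V \<and> V \<subseteq> U"
        by (intro bexI[OF _ rangeI[of A b]]) (use W in \<open>auto simp: A_def\<close>)
    qed
    moreover have "|range A| \<le>o continuum" unfolding continuum_eq by (rule card_of_image)
    ultimately show ?thesis unfolding weight_ordLeq_iff by blast
  qed
  ultimately show ?thesis by blast
qed

section \<open>Embedding into a monothetic group\<close>

definition continuous_seminorm :: "('a, 'm) monoid_scheme \<Rightarrow> 'a topology \<Rightarrow> ('a \<Rightarrow> real) \<Rightarrow> bool" where
  "continuous_seminorm G T p \<longleftrightarrow> group_seminorm G p \<and>
     (\<forall>e>0. \<exists>V. openin T V \<and> \<one>\<^bsub>G\<^esub> \<in> V \<and> (\<forall>x\<in>V. p x < e))"

locale comm_topgroup = comm_group G + topgroup G T for G (structure) and T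
begin

text \<open>\<open>birkhoff_kakutani\<close> is applied to symmetric neighbourhoods with triple
  products from \<open>V (Suc n)\<close> inside \<open>V n\<close>. As \<open>V 0\<close> has to be
  the carrier, containment in \<open>U\<close> starts at \<open>V 1\<close>, and 1/4 =
  \<open>(1/2) ^ Suc 1\<close> is the radius that guarantees membership in
  \<open>V 1\<close>.\<close>

lemma continuous_seminorm_within:
  assumes "openin T U" "\<one> \<in> U"
  shows "\<exists>p. continuous_seminorm G T p \<and> (\<forall>x\<in>carrier G. p x \<le> 1) \<and> (\<forall>x\<in>carrier G. p x < 1/4 \<longrightarrow> x \<in> U)"
proof -
  define P where "P n V \<longleftrightarrow> openin T V \<and> \<one> \<in> V \<and> (\<forall>x\<in>V. inv x \<in> V) \<and> (n = 0 \<longrightarrow> V = carrier G)"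
    for n :: nat and V
  define Q where "Q V V' \<longleftrightarrow> (\<forall>x\<in>V'. \<forall>y\<in>V'. \<forall>z\<in>V'. x \<otimes> y \<otimes> z \<in> V) \<and> V' \<subseteq> U" for V V' :: "'a set"
  have "\<exists>V. \<forall>n. P n (V n) \<and> Q (V n) (V (Suc n))"
  proof (rule dependent_nat_choice[where Q = "\<lambda>_. Q"])
    show "\<exists>V. P 0 V" by (auto simp: P_def openin_carrier)
    fix V n assume V: "P n V"
    have "openin T (V \<inter> U)" "\<one> \<in> V \<inter> U" using V assms by (auto simp: P_def)
    then obtain V' where V': "openin T V'" "\<one> \<in> V'" "V' \<subseteq> V \<inter> U" "\<forall>x\<in>V'. inv x \<in> V'"
      "\<forall>x\<in>V'. \<forall>y\<in>V'. \<forall>z\<in>V'. x \<otimes> y \<otimes> z \<in> V \<inter> U"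
      by (rule symmetric_nbhd_triple)
    then have "P (Suc n) V' \<and> Q V V'" by (auto simp: P_def Q_def)
    then show "\<exists>V'. P (Suc n) V' \<and> Q V V'" ..
  qed
  then obtain V where P: "\<And>n. P n (V n)" and Q: "\<And>n. Q (V n) (V (Suc n))" by blast
  have V: "V 0 = carrier G" "\<And>n. \<one> \<in> V n" "\<And>n. openin T (V n)" using P by (auto simp: P_def)
  obtain p where p: "group_seminorm G p" "\<forall>x\<in>carrier G. p x \<le> 1" "\<forall>n. \<forall>x\<in>V n. p x \<le> (1/2) ^ n"
    "\<forall>n. \<forall>x\<in>carrier G. p x < (1/2) ^ Suc n \<longrightarrow> x \<in> V n"
  proof (rule birkhoff_kakutani)
    show "V 0 = carrier G" "\<one> \<in> V n" "V n \<subseteq> carrier G" for n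
      using V open_subset by auto
    show "inv x \<in> V n" if "x \<in> V n" for x n using P[of n] that by (simp add: P_def)
    show "x \<otimes> y \<otimes> z \<in> V n" if "x \<in> V (Suc n)" "y \<in> V (Suc n)" "z \<in> V (Suc n)" for x y z n
      using Q[of n] that by (simp add: Q_def)
  qed
  have "\<exists>V. openin T V \<and> \<one> \<in> V \<and> (\<forall>x\<in>V. p x < e)" if e: "0 < e" for e
  proof -
    obtain n where "(1/2 :: real) ^ n < e" using real_arch_pow_inv[OF e, of "1/2"] by auto
    then have "\<forall>x\<in>V n. p x < e" using p(3) le_less_trans by blast
    then show ?thesis using V by blast
  qed
  moreover have "x \<in> U" if "x \<in> carrier G" "p x < 1/4" for x
    using p(4)[rule_format, of x 1] Q[of 0] that by (auto simp: Q_def power2_eq_square)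
  ultimately show ?thesis
    using p(1,2) unfolding continuous_seminorm_def by blast
qed

text \<open>For each \<open>n\<close>, countably many translates of a neighbourhood on which
  \<open>p\<close> is below \<open>1 / Suc n\<close> cover \<open>G\<close>; all their centres
  together are still countable.\<close>

lemma seminorm_dense_sequence:
  assumes bounded: "aleph0_bounded G T" and p: "continuous_seminorm G T p"
  shows "\<exists>d :: nat \<Rightarrow> 'a. range d \<subseteq> carrier G \<and> (\<forall>g\<in>carrier G. \<forall>e>0. \<exists>m. p (g \<otimes> inv (d m)) < e)"
proof -
  have "\<exists>C. C \<subseteq> carrier G \<and> countable C \<and> (\<forall>g\<in>carrier G. \<exists>c\<in>C. p (g \<otimes> inv c) < 1 / Suc n)" for n
  proof -
    have "(0 :: real) < 1 / Suc n" by simp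
    then obtain V where V: "openin T V" "\<one> \<in> V" "\<forall>x\<in>V. p x < 1 / Suc n"
      using p unfolding continuous_seminorm_def by blast
    have "openin T V \<and> V \<noteq> {}" using V by auto
    then have "\<exists>C. C \<subseteq> carrier G \<and> countable C \<and> carrier G = (\<Union>c\<in>C. c <# V)"
      by (rule bounded[unfolded aleph0_bounded_def, rule_format])
    then obtain C where C: "C \<subseteq> carrier G" "countable C" "carrier G = (\<Union>c\<in>C. c <# V)"
      by (elim exE conjE)
    have "\<exists>c\<in>C. p (g \<otimes> inv c) < 1 / Suc n" if g: "g \<in> carrier G" for g
    proof -
      obtain c where c: "c \<in> C" "g \<in> c <# V" using g C(3) by blast
      then obtain v where v: "v \<in> V" "g = c \<otimes> v" by (auto simp: l_coset_def)
      moreover have "v \<in> carrier G" "c \<in> carrier G" using v c C open_subset[OF V(1)] by auto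
      ultimately have "g \<otimes> inv c = v" by (simp add: m_comm[of c v] m_assoc)
      then show ?thesis using V v c by auto
    qed
    then show ?thesis using C by blast
  qed
  then have "\<exists>C. \<forall>n. C n \<subseteq> carrier G \<and> countable (C n) \<and>
      (\<forall>g\<in>carrier G. \<exists>c\<in>C n. p (g \<otimes> inv c) < 1 / Suc n)"
    by (intro choice allI)
  then obtain C where C_all: "\<forall>n. C n \<subseteq> carrier G \<and> countable (C n) \<and>
      (\<forall>g\<in>carrier G. \<exists>c\<in>C n. p (g \<otimes> inv c) < 1 / Suc n)"
    by (elim exE)
  have C: "C n \<subseteq> carrier G" "countable (C n)"
    "g \<in> carrier G \<Longrightarrow> \<exists>c\<in>C n. p (g \<otimes> inv c) < 1 / Suc n" for n g
    using C_all by simp_all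
  define D where "D = (\<Union>n. C n)"
  have D: "countable D" "D \<noteq> {}" "D \<subseteq> carrier G"
    using C(1,2) C(3)[OF one_closed] by (fastforce simp: D_def)+
  then have rng: "range (from_nat_into D) = D" by (simp add: range_from_nat_into)
  have "\<exists>m. p (g \<otimes> inv (from_nat_into D m)) < e" if g: "g \<in> carrier G" and e: "0 < e" for g e
  proof -
    obtain n where "inverse (real (Suc n)) < e" using reals_Archimedean[OF e] by blast
    moreover obtain c where "c \<in> C n" "p (g \<otimes> inv c) < 1 / Suc n" using C(3)[OF g] by blast
    moreover have "c \<in> range (from_nat_into D)"
      unfolding rng using \<open>c \<in> C n\<close> by (auto simp: D_def)
    then obtain m where "from_nat_into D m = c" by blast
    ultimately show ?thesis by (intro exI[of _ m]) (simp add: inverse_eq_divide)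
  qed
  then show ?thesis using rng D(3) by (intro exI[of _ "from_nat_into D"]) auto
qed

end

section \<open>The monothetic group on G \<times> \<int>\<close>

lemma comm_group_DirProd_integer_group:
  assumes "comm_group G"
  shows "comm_group (G \<times>\<times> integer_group)"
proof -
  interpret comm_group G by (rule assms)
  interpret H: group "G \<times>\<times> integer_group"
    by (intro DirProd_group group_axioms group_integer_group)
  show ?thesis
    by (rule H.group_comm_groupI) (auto simp: m_comm)
qed

lemma Pair_one_int_pow:
  assumes "group G"
  shows "(\<one>\<^bsub>G\<^esub>, 1) [^]\<^bsub>G \<times>\<times> integer_group\<^esub> (k :: int) = (\<one>\<^bsub>G\<^esub>, k)"
proof -
  interpret group G by (rule assms)
  have nat: "(\<one>\<^bsub>G\<^esub>, 1) [^]\<^bsub>G \<times>\<times> integer_group\<^esub> n = (\<one>\<^bsub>G\<^esub>, int n)" for n :: nat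
    by (induction n) (auto simp: nat_pow_def)
  show ?thesis
    by (auto simp: int_pow_def2 nat inv_DirProd[OF assms group_integer_group] inv_integer_group)
qed

text \<open>The index type serves twice: it can index a base of cardinality at most the continuum,
  and it indexes the independent functions. Assumptions \<open>p\<close> and \<open>p_nbhd\<close>
  together say that the seminorms define \<open>T\<close>.\<close>

locale bounded_comm_topgroup = comm_topgroup G T for G (structure) and T +
  fixes p :: "(nat \<Rightarrow> bool) \<Rightarrow> 'a \<Rightarrow> real" and d :: "(nat \<Rightarrow> bool) \<Rightarrow> nat \<Rightarrow> 'a"
  assumes p: "continuous_seminorm G T (p i)" and p_le_1: "x \<in> carrier G \<Longrightarrow> p i x \<le> 1"
    and p_nbhd: "\<lbrakk>openin T U; \<one> \<in> U\<rbrakk> \<Longrightarrow> \<exists>i. \<forall>x\<in>carrier G. p i x < 1/4 \<longrightarrow> x \<in> U"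
    and d: "d i n \<in> carrier G"
    and d_dense: "\<lbrakk>g \<in> carrier G; 0 < e\<rbrakk> \<Longrightarrow> \<exists>m. p i (g \<otimes> inv (d i m)) < e"
begin

text \<open>By \<open>independent_fun_hits\<close>, for finitely many \<open>i\<close> a common,
  arbitrarily large \<open>n\<close> makes each \<open>s i n\<close> a prescribed term of
  \<open>d i\<close>.\<close>

definition s :: "(nat \<Rightarrow> bool) \<Rightarrow> nat \<Rightarrow> 'a" where
  "s i n = d i (independent_fun i n)"

sublocale E: cyclic_extension G "p i" "s i" for i
  by unfold_locales (use p p_le_1 d in \<open>auto simp: continuous_seminorm_def s_def\<close>)

abbreviation "H \<equiv> G \<times>\<times> integer_group"

definition N :: "(nat \<Rightarrow> bool) \<Rightarrow> 'a \<times> int \<Rightarrow> real" where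
  "N i = E.ext i"

lemma N_Pair_0: "g \<in> carrier G \<Longrightarrow> N i (g, 0) = p i g"
  by (simp add: N_def E.ext_Pair_0)

sublocale H: seminormed_group H N
proof -
  interpret H: comm_group H by (rule comm_group_DirProd_integer_group[OF comm_group_axioms])
  show "seminormed_group H N"
  proof
    show "group_seminorm H (N i)" for i unfolding N_def by (rule E.group_seminorm_ext)
    fix x assume x: "x \<in> carrier H" "x \<noteq> \<one>\<^bsub>H\<^esub>"
    obtain g m where gm: "x = (g, m)" by fastforce
    \<comment> \<open>On G \<times> {0} the seminorms restrict to the \<open>p i\<close>, which
      separate points because \<open>T\<close> is Hausdorff; elsewhere \<open>ext_pos\<close>
      applies at every index.\<close>
    show "\<exists>i. 0 < N i x"
    proof (cases "m = 0")
      case True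
      then have g: "g \<in> carrier G" "g \<noteq> \<one>" using x gm by auto
      then obtain U where U: "openin T U" "\<one> \<in> U" "g \<notin> U"
        using Hausdorff unfolding Hausdorff_space_def topspace_eq disjnt_iff by (metis one_closed)
      then obtain i where "\<not> p i g < 1/4" using p_nbhd[OF U(1,2)] g by blast
      then have "0 < N i x" using N_Pair_0[OF g(1)] gm True by simp
      then show ?thesis by blast
    next
      case False
      then show ?thesis using E.ext_pos x gm by (auto simp: N_def)
    qed
  qed
qed

abbreviation "S \<equiv> seminorm_topology H N"

lemma H_diff: "\<lbrakk>g \<in> carrier G; h \<in> carrier G\<rbrakk> \<Longrightarrow> (g, m) \<otimes>\<^bsub>H\<^esub> inv\<^bsub>H\<^esub> (h, k) = (g \<otimes> inv h, m - k)"
  by (simp add: inv_DirProd[OF group_axioms group_integer_group] inv_integer_group)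

lemma monothetic_H: "monothetic H S"
  unfolding monothetic_def
proof (rule bexI[of _ "(\<one>, 1)"])
  have gen: "(\<one>, k) \<in> generate H {(\<one>, 1)}" for k
    using H.generate_pow[of "(\<one>, 1)"] by (auto simp: Pair_one_int_pow[OF group_axioms])
  show "S closure_of (generate H {(\<one>, 1)}) = topspace S"
    unfolding dense_intersects_open
  proof (intro allI impI, elim conjE)
    fix W assume W: "openin S W" "W \<noteq> {}"
    then obtain g m where gm: "(g, m) \<in> W" by auto
    obtain F e where F: "finite F" "0 < e" "seminorm_ball H N F e (g, m) \<subseteq> W"
      using W gm unfolding openin_seminorm_topology by blast
    have g: "g \<in> carrier G" using W gm unfolding openin_seminorm_topology by auto
    have "\<forall>i. \<exists>m. p i (g \<otimes> inv (d i m)) < e/2" using d_dense[OF g, of "e/2"] F(2) by simp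
    then obtain u where u: "\<And>i. p i (g \<otimes> inv (d i (u i))) < e/2" by metis
    obtain k where k: "inverse (real (Suc k)) < e/2" using reals_Archimedean[of "e/2"] F(2) by auto
    obtain n where n: "k \<le> n" "\<forall>i\<in>F. independent_fun i n = u i"
      using independent_fun_hits[OF F(1)] by blast
    have "1 / real (Suc n) \<le> 1 / real (Suc k)" using n(1) by (intro divide_left_mono) auto
    then have n2: "1 / real (Suc n) < e/2" using k by (simp add: inverse_eq_divide)
    \<comment> \<open>This differs from \<open>(g, m)\<close> by the inverse of
      \<open>(g, fact (Suc n))\<close>, whose seminorm for \<open>i \<in> F\<close> is at most
      \<open>p i (g \<otimes> inv (s i n)) + 1 / Suc n\<close>, with both terms below
      \<open>e/2\<close>.\<close>
    let ?z = "(\<one>, m - fact (Suc n))"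
    have "?z \<otimes>\<^bsub>H\<^esub> inv\<^bsub>H\<^esub> (g, m) = inv\<^bsub>H\<^esub> (g, fact (Suc n))"
      using g by (simp add: H_diff inv_DirProd[OF group_axioms group_integer_group] inv_integer_group del: fact_Suc)
    then have "N i (?z \<otimes>\<^bsub>H\<^esub> inv\<^bsub>H\<^esub> (g, m)) = N i (g, fact (Suc n))" for i
      using H.N_inv[of "(g, fact (Suc n))" i] g by (simp del: fact_Suc)
    moreover have "N i (g, fact (Suc n)) < e" if "i \<in> F" for i
      using E.ext_fact_le[OF g, of i n] u[of i] n(2) n2 that by (simp add: N_def s_def del: fact_Suc)
    ultimately have "?z \<in> seminorm_ball H N F e (g, m)"
      by (simp add: seminorm_ball_def del: fact_Suc)
    then show "generate H {(\<one>, 1)} \<inter> W \<noteq> {}" using F(3) gen by blast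
  qed
qed simp

lemma continuous_embedding: "continuous_map T S (\<lambda>g. (g, 0))"
  unfolding continuous_map topspace_seminorm_topology topspace_eq
proof (intro conjI allI impI)
  fix W assume W: "openin S W"
  show "openin T {g \<in> carrier G. (g, 0) \<in> W}"
  proof (subst openin_subopen, intro ballI)
    fix g assume "g \<in> {g \<in> carrier G. (g, 0) \<in> W}"
    then have g: "g \<in> carrier G" "(g, 0) \<in> W" by auto
    then obtain F e where F: "finite F" "0 < e" "seminorm_ball H N F e (g, 0) \<subseteq> W"
      using W unfolding openin_seminorm_topology by blast
    have "\<forall>i. \<exists>V. openin T V \<and> \<one> \<in> V \<and> (\<forall>x\<in>V. p i x < e)"
      using p F(2) unfolding continuous_seminorm_def by blast
    then obtain V where V: "\<And>i. openin T (V i)" "\<And>i. \<one> \<in> V i" "\<And>i x. x \<in> V i \<Longrightarrow> p i x < e"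
      by metis
    \<comment> \<open>Intersecting with the space keeps \<open>V'\<close> open when \<open>F\<close>
      is empty.\<close>
    define V' where "V' = (\<Inter>i\<in>F. V i) \<inter> topspace T"
    have V': "openin T V'" unfolding V'_def using F(1) V(1) by (rule openin_INT)
    let ?X = "{x \<in> carrier G. x \<otimes> inv g \<in> V'}"
    have "openin T ?X" using V' g by (intro openin_right_translate) auto
    moreover have "g \<in> ?X" using g V(2) by (simp add: V'_def topspace_eq)
    moreover have "?X \<subseteq> {g \<in> carrier G. (g, 0) \<in> W}"
    proof
      fix x assume x: "x \<in> ?X"
      then have "(x, 0) \<in> seminorm_ball H N F e (g, 0)"
        using g V(3) by (simp add: seminorm_ball_def H_diff N_Pair_0 V'_def)
      then show "x \<in> {g \<in> carrier G. (g, 0) \<in> W}" using F(3) x by blast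
    qed
    ultimately show "\<exists>X. openin T X \<and> g \<in> X \<and> X \<subseteq> {g \<in> carrier G. (g, 0) \<in> W}"
      by (intro exI[of _ ?X] conjI)
  qed
qed auto

text \<open>After translation to the identity, \<open>p_nbhd\<close> supplies a single index whose
  ball of radius 1/4 fits into the given open set.\<close>

lemma continuous_inverse_embedding: "continuous_map (subtopology S (carrier G \<times> {0})) T fst"
  unfolding continuous_map
proof (intro conjI allI impI)
  show "fst ` topspace (subtopology S (carrier G \<times> {0})) \<subseteq> topspace T"
    by (auto simp: topspace_eq)
  fix X assume X: "openin T X"
  let ?K = "carrier G \<times> {0 :: int}"
  let ?Y = "{x \<in> topspace (subtopology S ?K). fst x \<in> X}"
  show "openin (subtopology S ?K) ?Y"
  proof (subst openin_subopen, intro ballI)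
    fix z assume "z \<in> ?Y"
    then obtain g where z: "z = (g, 0)" and g: "g \<in> carrier G" "g \<in> X" by auto
    let ?X = "{x \<in> carrier G. x \<otimes> g \<in> X}"
    have "openin T ?X" "\<one> \<in> ?X" using X g by (auto intro: openin_right_translate)
    then obtain i where i: "\<forall>x\<in>carrier G. p i x < 1/4 \<longrightarrow> x \<in> ?X" using p_nbhd by meson
    let ?B = "seminorm_ball H N {i} (1/4) (g, 0)"
    have "openin S ?B" using g by (intro H.openin_seminorm_ball) auto
    then have "openin (subtopology S ?K) (?B \<inter> ?K)" by (rule openin_subtopology_Int)
    moreover have "z \<in> ?B \<inter> ?K"
      using g z by (auto intro: H.centre_in_seminorm_ball)
    moreover have "?B \<inter> ?K \<subseteq> ?Y"
    proof
      fix y assume y: "y \<in> ?B \<inter> ?K"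
      then obtain h where h: "y = (h, 0)" "h \<in> carrier G" by auto
      then have "p i (h \<otimes> inv g) < 1/4"
        using y g by (simp add: seminorm_ball_def H_diff N_Pair_0)
      then have "(h \<otimes> inv g) \<otimes> g \<in> X" using i h g by simp
      then show "y \<in> ?Y" using h g by (simp add: m_assoc topspace_seminorm_topology)
    qed
    ultimately show "\<exists>A. openin (subtopology S ?K) A \<and> z \<in> A \<and> A \<subseteq> ?Y"
      by (intro exI[of _ "?B \<inter> ?K"] conjI)
  qed
qed

lemma embeds: "embeds_in_monothetic_group G T"
proof (rule embeds_in_monothetic_group_if)
  show "topological_group H S" by (rule H.topological_group_seminorm_topology)
  show "monothetic H S" by (rule monothetic_H)
  let ?K = "carrier G \<times> {0 :: int}"
  have "subgroup ?K H"
    by (rule H.subgroupI)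
      (auto simp: inv_DirProd[OF group_axioms group_integer_group] inv_integer_group)
  moreover have "(\<lambda>g. (g, 0)) \<in> iso G (H\<lparr>carrier := ?K\<rparr>)"
    by (auto simp: iso_def hom_def bij_betw_def inj_on_def)
  moreover have "homeomorphic_map T (subtopology S ?K) (\<lambda>g. (g, 0))"
    unfolding homeomorphic_map_maps homeomorphic_maps_def
  proof (intro exI[of _ fst] conjI)
    show "continuous_map T (subtopology S ?K) (\<lambda>g. (g, 0))"
      using continuous_embedding by (auto simp: continuous_map_in_subtopology topspace_eq)
  qed (auto simp: continuous_inverse_embedding)
  ultimately show "iso_to_topological_subgroup G T H S"
    unfolding iso_to_topological_subgroup_def topological_group_iso_def by blast
qed

end

lemma embeds_in_monothetic_groupI:
  fixes G :: "('a, 'm) monoid_scheme"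
  assumes tg: "topological_group G T" and comm: "comm_group G"
    and bounded: "aleph0_bounded G T" and weight: "weight T \<le>o continuum"
  shows "embeds_in_monothetic_group G T"
proof -
  interpret comm_group G by (rule comm)
  interpret comm_topgroup G T by unfold_locales (rule tg)
  obtain \<B> where \<B>: "base_of T \<B>" "|\<B>| \<le>o continuum"
    using weight unfolding weight_ordLeq_iff by blast
  have ne: "\<B> \<noteq> {}" using \<B>(1) openin_carrier one_closed unfolding base_of_def by blast
  obtain B :: "(nat \<Rightarrow> bool) \<Rightarrow> 'a set" where B: "range B = \<B>"
    using card_of_ordLeq2[OF ne, of "UNIV :: (nat \<Rightarrow> bool) set"] \<B>(2) unfolding continuum_eq by blast
  \<comment> \<open>Base members missing the identity are replaced by the carrier, so that every
    binary sequence indexes a neighbourhood of the identity and these still form a neighbourhood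
    base there.\<close>
  define U where "U i = (if \<one>\<^bsub>G\<^esub> \<in> B i then B i else carrier G)" for i
  have U: "openin T (U i)" "\<one>\<^bsub>G\<^esub> \<in> U i" for i
    using \<B>(1) B openin_carrier by (auto simp: U_def base_of_def)
  have "\<forall>i. \<exists>p. continuous_seminorm G T p \<and> (\<forall>x\<in>carrier G. p x \<le> 1) \<and> (\<forall>x\<in>carrier G. p x < 1/4 \<longrightarrow> x \<in> U i)"
    using continuous_seminorm_within[OF U] by blast
  then obtain p where p: "\<And>i. continuous_seminorm G T (p i)" "\<And>i x. x \<in> carrier G \<Longrightarrow> p i x \<le> 1"
    "\<And>i x. \<lbrakk>x \<in> carrier G; p i x < 1/4\<rbrakk> \<Longrightarrow> x \<in> U i"
    by metis
  have "\<forall>i. \<exists>d :: nat \<Rightarrow> 'a. range d \<subseteq> carrier G \<and> (\<forall>g\<in>carrier G. \<forall>e>0. \<exists>m. p i (g \<otimes>\<^bsub>G\<^esub> inv\<^bsub>G\<^esub> (d m)) < e)"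
    using seminorm_dense_sequence[OF bounded p(1)] by blast
  then obtain d :: "(nat \<Rightarrow> bool) \<Rightarrow> nat \<Rightarrow> 'a" where d: "\<And>i. range (d i) \<subseteq> carrier G"
    "\<And>i g e. \<lbrakk>g \<in> carrier G; 0 < e\<rbrakk> \<Longrightarrow> \<exists>m. p i (g \<otimes>\<^bsub>G\<^esub> inv\<^bsub>G\<^esub> (d i m)) < e"
    by metis
  interpret bounded_comm_topgroup G T p d
  proof
    fix W assume W: "openin T W" "\<one>\<^bsub>G\<^esub> \<in> W"
    then obtain V where V: "V \<in> \<B>" "\<one>\<^bsub>G\<^esub> \<in> V" "V \<subseteq> W" using \<B>(1) unfolding base_of_def by blast
    obtain i where "B i = V" using V(1) B by blast
    then have "U i \<subseteq> W" using V(2,3) by (simp add: U_def)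
    then show "\<exists>i. \<forall>x\<in>carrier G. p i x < 1/4 \<longrightarrow> x \<in> W" using p(3) by blast
  qed (use p d(2) range_subsetD[OF d(1)] in auto)
  show ?thesis by (rule embeds)
qed

theorem corollary1p2:
  fixes G :: "('a, 'm) monoid_scheme" and T :: "'a topology"
  assumes "topological_group G T"
  shows "embeds_in_monothetic_group G T \<longleftrightarrow>
           comm_group G \<and> aleph0_bounded G T \<and> weight T \<le>o continuum"
  using embeds_in_monothetic_group_imp[OF assms] embeds_in_monothetic_groupI[OF assms] by blast

end
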